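(* For all $n\geq 1$ and all $j,k\geq 2$ with $j<k$, $\mathsf{RT}^n_k \nleq_{\mathrm{sW}} \mathsf{RT}^n_j$.
   Context: For $n,k\geq1$, $\mathsf{RT}^n_k$ is the $\Pi^1_2$ principle whose instances are colorings $f:[\omega]^n\to k$ (where $[\omega]^n$ is the set of $n$-element subsets of $\omega$ and $k=\{0,\dots,k-1\}$) and whose solutions are infinite sets $H\subseteq\omega$ homogeneous for $f$, i.e. $f$ is constant on $[H]^n$. For $\Pi^1_2$ principles viewed as problems (instances and solutions), $\mathsf{P}\leq_{\mathrm{sW}}\mathsf{Q}$ means there are Turing functionals $\Phi,\Psi$ such that for every instance $A$ of $\mathsf{P}$, $\Phi(A)$ is an instance of $\mathsf{Q}$, and for every solution $T$ to $\Phi(A)$, $\Psi(T)$ is a solution to $A$. *)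

theory Defs
  imports Main "HOL-Library.Nat_Bijection"
begin

text \<open>Codes of partial recursive functions relative to an oracle A :: nat => nat.
  A Turing functional is such a code; Phi^A(x) is the value of the code on the
  argument list [x] with oracle A.\<close>

datatype recf =
    Zero
  | Succ
  | Proj nat
  | Orc
  | Comp recf "recf list"
  | Prim recf recf
  | Mn recf

lemma list_all2_mono_ind [mono]:
  "(\<And>x y. P x y \<longrightarrow> Q x y) \<Longrightarrow> list_all2 P xs ys \<longrightarrow> list_all2 Q xs ys"
  by (auto elim: list_all2_mono)

inductive eval :: "(nat \<Rightarrow> nat) \<Rightarrow> recf \<Rightarrow> nat list \<Rightarrow> nat \<Rightarrow> bool"
  for A :: "nat \<Rightarrow> nat" where
  eval_zero: "eval A Zero xs 0"
| eval_succ: "eval A Succ (x # xs) (Suc x)"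
| eval_proj: "i < length xs \<Longrightarrow> eval A (Proj i) xs (xs ! i)"
| eval_orc: "eval A Orc (x # xs) (A x)"
| eval_comp: "list_all2 (\<lambda>g y. eval A g xs y) gs ys \<Longrightarrow> eval A f ys z
               \<Longrightarrow> eval A (Comp f gs) xs z"
| eval_prim0: "eval A f xs z \<Longrightarrow> eval A (Prim f g) (0 # xs) z"
| eval_primS: "eval A (Prim f g) (n # xs) r \<Longrightarrow> eval A g (r # n # xs) z
               \<Longrightarrow> eval A (Prim f g) (Suc n # xs) z"
| eval_mn: "eval A f (y # xs) 0 \<Longrightarrow> (\<forall>z<y. \<exists>v. 0 < v \<and> eval A f (z # xs) v)
               \<Longrightarrow> eval A (Mn f) xs y"

definition computes :: "recf \<Rightarrow> (nat \<Rightarrow> nat) \<Rightarrow> (nat \<Rightarrow> nat) \<Rightarrow> bool" where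
  "computes e A F \<longleftrightarrow> (\<forall>x. eval A e [x] (F x))"

text \<open>A problem: a set of (names of) instances and, for each instance, the set of
  (names of) its solutions. Names are elements of Baire space nat => nat.\<close>
record problem =
  inst :: "(nat \<Rightarrow> nat) set"
  sols :: "(nat \<Rightarrow> nat) \<Rightarrow> (nat \<Rightarrow> nat) set"

definition sW_le :: "problem \<Rightarrow> problem \<Rightarrow> bool" where
  "sW_le P Q \<longleftrightarrow> (\<exists>Phi Psi. \<forall>A \<in> inst P. \<exists>B. computes Phi A B \<and> B \<in> inst Q \<and>
       (\<forall>T \<in> sols Q B. \<exists>S. computes Psi T S \<and> S \<in> sols P A))"

text \<open>A coloring f : [omega]^n -> k (only values on n-element sets matter).\<close>
definition coloring :: "nat \<Rightarrow> nat \<Rightarrow> (nat set \<Rightarrow> nat) \<Rightarrow> bool" where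
  "coloring n k f \<longleftrightarrow> (\<forall>s. finite s \<and> card s = n \<longrightarrow> f s < k)"

definition col_name :: "nat \<Rightarrow> (nat set \<Rightarrow> nat) \<Rightarrow> nat \<Rightarrow> nat" where
  "col_name n f = (\<lambda>x. if card (set_decode x) = n then f (set_decode x) else 0)"

definition chr :: "nat set \<Rightarrow> nat \<Rightarrow> nat" where
  "chr H = (\<lambda>x. if x \<in> H then 1 else 0)"

definition homogeneous_name :: "nat \<Rightarrow> (nat \<Rightarrow> nat) \<Rightarrow> nat set \<Rightarrow> bool" where
  "homogeneous_name n A H \<longleftrightarrow> infinite H \<and>
     (\<exists>c. \<forall>s. s \<subseteq> H \<and> finite s \<and> card s = n \<longrightarrow> A (set_encode s) = c)"

definition RT :: "nat \<Rightarrow> nat \<Rightarrow> problem" where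
  "RT n k = \<lparr> inst = {col_name n f | f. coloring n k f},
              sols = (\<lambda>A. {chr H | H. homogeneous_name n A H}) \<rparr>"

end

theory Submission
  imports Defs "HOL-Library.Countable" "HOL-Library.Infinite_Set"
begin

text \<open>Only the continuity of Turing functionals matters. Call \<open>F\<close> of class \<open>m\<close> if it is an \<open>m\<close>-fold
  pointwise limit of locally constant functions on Baire space.

  Jockusch's analysis of Ramsey's theorem gives, for a \<open>j\<close>-colouring \<open>g\<close> of \<open>n\<close>-sets, candidate sets
  \<open>H c g\<close> for \<open>c < j\<close>, each of class \<open>n\<close> in \<open>g\<close>, such that some \<open>H c g\<close> is infinite and homogeneous: a path
  of the Erdos--Rado tree reduces \<open>n + 1\<close> to \<open>n\<close>, and choosing the path by the low basis theorem makes
  this cost one limit instead of two.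

  Given a reduction \<open>(\<Phi>, \<Psi>)\<close>, the least element of \<open>\<Psi> (H c (\<Phi> f))\<close> is therefore an \<open>n\<close>-fold limit of values
  \<open>\<xi>\<^sub>c(x\<^sub>1, \<dots>, x\<^sub>n)\<close> that depend on \<open>f\<close> below \<open>x\<^sub>n\<close> only. Define \<open>f\<close> recursively so that the colour of
  \<open>{x\<^sub>1, \<dots>, x\<^sub>n}\<close> differs from that of \<open>{\<xi>\<^sub>c, x\<^sub>2, \<dots>, x\<^sub>n}\<close> for all \<open>c < j\<close>; more than \<open>j\<close> colours suffice for
  this. Then no \<open>\<Psi> (H c (\<Phi> f))\<close> is an infinite homogeneous set for \<open>f\<close>.\<close>

section \<open>Baire classes\<close>

definition locally_const :: "((nat \<Rightarrow> nat) \<Rightarrow> 'b) \<Rightarrow> bool" where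
  "locally_const F \<longleftrightarrow> (\<forall>g. \<exists>m. \<forall>g'. (\<forall>x<m. g' x = g x) \<longrightarrow> F g' = F g)"

lemma locally_constE:
  assumes "locally_const F"
  obtains m where "\<And>g'. (\<forall>x<m. g' x = g x) \<Longrightarrow> F g' = F g"
  using assms unfolding locally_const_def by blast

text \<open>Limits are limits of eventually constant sequences. By the limit lemma, for countable
  ranges class \<open>m\<close> corresponds to computability in the \<open>m\<close>-th jump of
  \<open>g\<close> and a fixed parameter.\<close>

primrec baire :: "nat \<Rightarrow> ((nat \<Rightarrow> nat) \<Rightarrow> 'b) \<Rightarrow> bool" where
  "baire 0 F \<longleftrightarrow> locally_const F"
| "baire (Suc m) F \<longleftrightarrow> (\<exists>G. (\<forall>i. baire m (G i)) \<and> (\<forall>g. \<forall>\<^sub>F i in sequentially. G i g = F g))"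

lemma baire_SucI:
  assumes "\<And>i. baire m (G i)" and "\<And>g. \<forall>\<^sub>F i in sequentially. G i g = F g"
  shows "baire (Suc m) F"
  using assms by auto

section \<open>Closure under substitution, Boolean operations, quantifiers and minimisation\<close>

lemma locally_const_const: "locally_const (\<lambda>g. c)"
  by (simp add: locally_const_def)

lemma baire_const: "baire m (\<lambda>g. c)"
  by (induction m) (auto simp: locally_const_const intro!: exI[of _ "\<lambda>i g. c"])

lemma baire_Suc: "baire m F \<Longrightarrow> baire (Suc m) F"
  by (rule baire_SucI[of m "\<lambda>_. F"]) auto

lemma baire_mono: "m \<le> m' \<Longrightarrow> baire m F \<Longrightarrow> baire m' F"
  by (induction m' rule: dec_induct) (use baire_Suc in blast)+

text \<open>Both limits run along the same stage: once \<open>J i g\<close> has settled to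
  \<open>I g\<close>, it remains to wait until \<open>S (I g) i g\<close> settles. Substituting an
  index thus costs no extra limit.\<close>

lemma baire_diag:
  assumes "baire m I" and "\<And>a. baire m (R a)"
  shows "baire m (\<lambda>g. R (I g) g)"
  using assms
proof (induction m arbitrary: I R)
  case 0
  show ?case
    unfolding baire.simps locally_const_def
  proof
    fix g
    obtain m1 where m1: "\<And>g'. (\<forall>x<m1. g' x = g x) \<Longrightarrow> I g' = I g"
      by (rule locally_constE[OF 0(1)[unfolded baire.simps], where g = g]) blast
    obtain m2 where m2: "\<And>g'. (\<forall>x<m2. g' x = g x) \<Longrightarrow> R (I g) g' = R (I g) g"
      by (rule locally_constE[OF 0(2)[of "I g", unfolded baire.simps], where g = g]) blast
    show "\<exists>m. \<forall>g'. (\<forall>x<m. g' x = g x) \<longrightarrow> R (I g') g' = R (I g) g"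
    proof (intro exI[of _ "max m1 m2"] allI impI)
      fix g' assume g': "\<forall>x<max m1 m2. g' x = g x"
      then have "I g' = I g" by (intro m1) simp
      moreover have "R (I g) g' = R (I g) g" using g' by (intro m2) simp
      ultimately show "R (I g') g' = R (I g) g" by simp
    qed
  qed
next
  case (Suc m)
  obtain J where J: "\<And>i. baire m (J i)" "\<And>g. \<forall>\<^sub>F i in sequentially. J i g = I g"
    using Suc.prems(1) by auto
  have "\<forall>a. \<exists>S. (\<forall>i. baire m (S i)) \<and> (\<forall>g. \<forall>\<^sub>F i in sequentially. S i g = R a g)"
    using Suc.prems(2) by auto
  then obtain S where S: "\<And>a i. baire m (S a i)"
      "\<And>a g. \<forall>\<^sub>F i in sequentially. S a i g = R a g"
    by metis
  show ?case
  proof (rule baire_SucI[where G = "\<lambda>i g. S (J i g) i g"])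
    show "baire m (\<lambda>g. S (J i g) i g)" for i
      using Suc.IH[of "J i" "\<lambda>a. S a i"] J(1) S(1) by blast
    show "\<forall>\<^sub>F i in sequentially. S (J i g) i g = R (I g) g" for g
      using J(2)[of g] S(2)[of "I g" g] by eventually_elim auto
  qed
qed

lemma baire_comp: "baire m F \<Longrightarrow> baire m (\<lambda>g. h (F g))"
  by (rule baire_diag[of m F "\<lambda>a g. h a"]) (simp_all add: baire_const)

lemma baire_comp2:
  assumes "baire m F" and "baire m G"
  shows "baire m (\<lambda>g. h (F g) (G g))"
  by (rule baire_diag[of m F "\<lambda>a g. h a (G g)", OF assms(1) baire_comp[OF assms(2)]])

lemma baire_map:
  assumes "\<And>i. i \<in> set xs \<Longrightarrow> baire m (F i)"
  shows "baire m (\<lambda>g. map (\<lambda>i. F i g) xs)"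
  using assms
proof (induction xs)
  case Nil
  show ?case by (simp add: baire_const)
next
  case (Cons a xs)
  then show ?case
    using baire_comp2[of m "F a" "\<lambda>g. map (\<lambda>i. F i g) xs" "(#)"] by simp
qed

lemma baire_finite_Ball:
  assumes "finite S" and "\<And>i. i \<in> S \<Longrightarrow> baire m (P i)"
  shows "baire m (\<lambda>g. \<forall>i\<in>S. P i g)"
  using assms
proof (induction S)
  case empty
  show ?case by (simp add: baire_const)
next
  case (insert a S)
  then show ?case
    using baire_comp2[of m "P a" "\<lambda>g. \<forall>i\<in>S. P i g" "(\<and>)"] by simp
qed

lemma baire_not: "baire m P \<Longrightarrow> baire m (\<lambda>g. \<not> P g)"
  by (rule baire_comp)

lemma baire_conj: "baire m P \<Longrightarrow> baire m Q \<Longrightarrow> baire m (\<lambda>g. P g \<and> Q g)"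
  by (rule baire_comp2)

lemma baire_finite_Bex:
  assumes "finite S" and "\<And>i. i \<in> S \<Longrightarrow> baire m (P i)"
  shows "baire m (\<lambda>g. \<exists>i\<in>S. P i g)"
  using baire_not[OF baire_finite_Ball[OF assms(1), of m "\<lambda>i g. \<not> P i g"]]
    baire_not[OF assms(2)] by simp

text \<open>Searching the first \<open>N\<close> candidates gives the right answer for all large
  \<open>N\<close>, so a countable quantifier costs one limit.\<close>

lemma baire_ex:
  fixes P :: "'i::countable \<Rightarrow> (nat \<Rightarrow> nat) \<Rightarrow> bool"
  assumes "\<And>i. baire m (P i)"
  shows "baire (Suc m) (\<lambda>g. \<exists>i. P i g)"
proof (rule baire_SucI[where G = "\<lambda>N g. \<exists>i\<in>{..<N}. P (from_nat i) g"])
  show "baire m (\<lambda>g. \<exists>i\<in>{..<N}. P (from_nat i) g)" for N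
    by (rule baire_finite_Bex) (auto simp: assms)
  show "\<forall>\<^sub>F N in sequentially. (\<exists>i\<in>{..<N}. P (from_nat i) g) = (\<exists>i. P i g)" for g
  proof (cases "\<exists>i. P i g")
    case True
    then obtain i where "P i g" by blast
    then have "\<exists>i\<in>{..<N}. P (from_nat i) g" if "N \<ge> Suc (to_nat i)" for N
      using that by (intro bexI[of _ "to_nat i"]) auto
    with True show ?thesis
      by (intro eventually_sequentiallyI[of "Suc (to_nat i)"]) simp
  next
    case False
    then show ?thesis by simp
  qed
qed

lemma baire_all:
  fixes P :: "'i::countable \<Rightarrow> (nat \<Rightarrow> nat) \<Rightarrow> bool"
  assumes "\<And>i. baire m (P i)"
  shows "baire (Suc m) (\<lambda>g. \<forall>i. P i g)"
  using baire_not[OF baire_ex[of m "\<lambda>i g. \<not> P i g", OF baire_not[OF assms]]] by simp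

text \<open>The bound \<open>i\<close> makes the result a function of the finite list of truth
  values of \<open>Q N\<close> for \<open>N < i\<close>, so no limit is spent.\<close>

lemma baire_bounded_Least:
  fixes Q :: "nat \<Rightarrow> (nat \<Rightarrow> nat) \<Rightarrow> bool"
  assumes "\<And>N. baire m (Q N)"
  shows "baire m (\<lambda>g. LEAST N. N = i \<or> Q N g)"
proof -
  define L where "L l = (LEAST N. N = i \<or> (N < i \<and> l ! N))" for l :: "bool list"
  have eq: "(LEAST N. N = i \<or> Q N g) = L (map (\<lambda>N. Q N g) [0..<i])" for g
  proof -
    have *: "(LEAST N. N = i \<or> Q N g) = (LEAST N. N = i \<or> (N < i \<and> Q N g))"
    proof (rule Least_equality)
      let ?M = "LEAST N. N = i \<or> (N < i \<and> Q N g)"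
      have "?M = i \<or> (?M < i \<and> Q ?M g)" by (rule LeastI[of _ i]) simp
      then show "?M = i \<or> Q ?M g" by blast
      have le: "?M \<le> i" by (rule Least_le) simp
      show "?M \<le> y" if "y = i \<or> Q y g" for y
      proof (cases "y < i")
        case True
        with that show ?thesis by (intro Least_le) auto
      next
        case False
        with le show ?thesis by simp
      qed
    qed
    have "(\<lambda>N. N = i \<or> (N < i \<and> Q N g)) = (\<lambda>N. N = i \<or> (N < i \<and> map (\<lambda>N. Q N g) [0..<i] ! N))"
      by (auto simp: fun_eq_iff)
    with * show ?thesis by (simp add: L_def)
  qed
  show ?thesis
    unfolding eq by (rule baire_comp) (simp add: baire_map assms)
qed

lemma eventually_ball_less:
  fixes P :: "nat \<Rightarrow> nat \<Rightarrow> bool"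
  assumes "\<And>N. \<forall>\<^sub>F i in sequentially. P N i"
  shows "\<forall>\<^sub>F i in sequentially. \<forall>N<M. P N i"
  using eventually_ball_finite[of "{..<M}" "\<lambda>i N. P N i" sequentially] assms
  by (simp add: Ball_def)

lemma eventually_bounded_Least:
  fixes P :: "nat \<Rightarrow> nat \<Rightarrow> bool" and Q :: "nat \<Rightarrow> bool"
  assumes "\<And>N. \<forall>\<^sub>F i in sequentially. P i N = Q N" and "\<exists>N. Q N"
  shows "\<forall>\<^sub>F i in sequentially. (LEAST N. N = i \<or> P i N) = (LEAST N. Q N)"
proof -
  let ?M = "LEAST N. Q N"
  have QM: "Q ?M" using assms(2) by (rule LeastI_ex)
  have ev: "\<forall>\<^sub>F i in sequentially. \<forall>N<Suc ?M. P i N = Q N"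
    by (rule eventually_ball_less) (rule assms(1))
  show ?thesis
    using ev eventually_ge_at_top[of ?M]
  proof eventually_elim
    case (elim i)
    show ?case
    proof (rule Least_equality)
      show "?M = i \<or> P i ?M" using elim QM by auto
      show "?M \<le> y" if "y = i \<or> P i y" for y
      proof (rule ccontr)
        assume "\<not> ?M \<le> y"
        then have "y < ?M" by simp
        then have "\<not> Q y" by (rule not_less_Least)
        then show False using elim that \<open>y < ?M\<close> by auto
      qed
    qed
  qed
qed

text \<open>Since a witness exists, the search through the \<open>i\<close>-th approximations with
  cut-off \<open>i\<close> converges to the true minimum. Minimisation therefore keeps the class,
  unlike a countable quantifier.\<close>

lemma baire_Least:
  fixes Q :: "nat \<Rightarrow> (nat \<Rightarrow> nat) \<Rightarrow> bool"
  assumes "\<And>N. baire (Suc m) (Q N)" and "\<And>g. \<exists>N. Q N g"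
  shows "baire (Suc m) (\<lambda>g. LEAST N. Q N g)"
proof -
  have "\<forall>N. \<exists>S. (\<forall>i. baire m (S i)) \<and> (\<forall>g. \<forall>\<^sub>F i in sequentially. S i g = Q N g)"
    using assms(1) by auto
  then obtain S where S: "\<And>N i. baire m (S N i)"
      "\<And>N g. \<forall>\<^sub>F i in sequentially. S N i g = Q N g"
    by metis
  show ?thesis
  proof (rule baire_SucI[where G = "\<lambda>i g. LEAST N. N = i \<or> S N i g"])
    show "baire m (\<lambda>g. LEAST N. N = i \<or> S N i g)" for i
      by (rule baire_bounded_Least) (rule S(1))
    show "\<forall>\<^sub>F i in sequentially. (LEAST N. N = i \<or> S N i g) = (LEAST N. Q N g)" for g
      by (rule eventually_bounded_Least) (use S(2) assms(2) in auto)
  qed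
qed

section \<open>Composition with continuous maps and with maps of controlled jump\<close>

lemma locally_const_finite:
  fixes G :: "(nat \<Rightarrow> nat) \<Rightarrow> nat \<Rightarrow> nat"
  assumes "\<And>x. locally_const (\<lambda>f. G f x)"
  shows "\<exists>m. \<forall>f'. (\<forall>x<m. f' x = f x) \<longrightarrow> (\<forall>x<M. G f' x = G f x)"
proof (induction M)
  case (Suc M)
  then obtain m1 where m1: "\<And>f'. (\<forall>x<m1. f' x = f x) \<Longrightarrow> (\<forall>x<M. G f' x = G f x)" by blast
  obtain m2 where m2: "\<And>f'. (\<forall>x<m2. f' x = f x) \<Longrightarrow> G f' M = G f M"
    by (rule locally_constE[OF assms[of M], where g = f]) blast
  show ?case
  proof (intro exI[of _ "max m1 m2"] allI impI)
    fix f' x assume f': "\<forall>x<max m1 m2. f' x = f x" and "x < Suc M"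
    have "\<forall>x<M. G f' x = G f x" using f' by (intro m1) simp
    moreover have "G f' M = G f M" using f' by (intro m2) simp
    ultimately show "G f' x = G f x" using \<open>x < Suc M\<close> by (auto simp: less_Suc_eq)
  qed
qed auto

lemma baire_precomp:
  fixes G :: "(nat \<Rightarrow> nat) \<Rightarrow> nat \<Rightarrow> nat"
  assumes "baire m P" and "\<And>x. locally_const (\<lambda>f. G f x)"
  shows "baire m (\<lambda>f. P (G f))"
  using assms(1)
proof (induction m arbitrary: P)
  case 0
  show ?case
    unfolding baire.simps locally_const_def
  proof
    fix f
    obtain M where M: "\<And>g'. (\<forall>x<M. g' x = G f x) \<Longrightarrow> P g' = P (G f)"
      by (rule locally_constE[OF 0[unfolded baire.simps], where g = "G f"]) blast
    show "\<exists>m. \<forall>f'. (\<forall>x<m. f' x = f x) \<longrightarrow> P (G f') = P (G f)"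
    proof -
      obtain m where m: "\<forall>f'. (\<forall>x<m. f' x = f x) \<longrightarrow> (\<forall>x<M. G f' x = G f x)"
        using locally_const_finite[where G = G and f = f and M = M, OF assms(2)] by (rule exE)
      show ?thesis
      proof (intro exI[of _ m] allI impI)
        fix f' assume "\<forall>x<m. f' x = f x"
        with m have "\<forall>x<M. G f' x = G f x" by (elim allE[of _ f'] impE)
        then show "P (G f') = P (G f)" by (rule M)
      qed
    qed
  qed
next
  case (Suc m)
  then obtain Q where Q: "\<And>i. baire m (Q i)" "\<And>g. \<forall>\<^sub>F i in sequentially. Q i g = P g" by auto
  show ?case
    by (rule baire_SucI[where G = "\<lambda>i f. Q i (G f)"]) (use Suc.IH Q in auto)
qed

text \<open>Composing with a map \<open>B\<close> of class \<open>r + 1\<close> usually adds \<open>r + 1\<close> to the class. It adds only \<open>r\<close>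
  when \<open>B\<close> has a controlled jump, i.e. when countably many open questions about \<open>B g\<close>, fixed in
  advance, are themselves of class \<open>r + 1\<close> in \<open>g\<close>.\<close>

lemma baire_jump_comp:
  assumes "baire (Suc m) (P :: (nat \<Rightarrow> nat) \<Rightarrow> bool)"
  shows "\<exists>F :: nat list \<Rightarrow> nat \<Rightarrow> (nat \<Rightarrow> nat) \<Rightarrow> bool. (\<forall>ys l. locally_const (F ys l)) \<and>
    (\<forall>r B. (\<forall>ys N v. baire (Suc r) (\<lambda>g. \<exists>l\<ge>N. F ys l (B g) \<noteq> v))
       \<longrightarrow> baire (Suc r + m) (\<lambda>g. P (B g)))"
  using assms
proof (induction m arbitrary: P)
  case 0
  then obtain G where G: "\<And>l. locally_const (G l)" "\<And>b. \<forall>\<^sub>F l in sequentially. G l b = P b" by auto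
  have "baire (Suc r) (\<lambda>g. P (B g))"
    if W: "\<And>N v. baire (Suc r) (\<lambda>g. \<exists>l\<ge>N. G l (B g) \<noteq> v)" for r B
  proof -
    \<comment> \<open>\<open>Q N\<close> and \<open>R N\<close> say that \<open>G l (B g)\<close> is
      true, respectively false, for all \<open>l\<close> from \<open>N\<close> on. Both are negated
      controlled questions. At the least \<open>N\<close> where one of them holds, the truth of
      \<open>Q N\<close> is the truth of \<open>P (B g)\<close>.\<close>
    define Q where "Q N g \<longleftrightarrow> \<not> (\<exists>l\<ge>N. G l (B g) \<noteq> True)" for N g
    define R where "R N g \<longleftrightarrow> \<not> (\<exists>l\<ge>N. G l (B g) \<noteq> False)" for N g
    have bQ: "baire (Suc r) (Q N)" for N
      unfolding Q_def by (rule baire_not) (rule W)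
    have bR: "baire (Suc r) (R N)" for N
      unfolding R_def by (rule baire_not) (rule W)
    have lim: "\<exists>N. \<forall>l\<ge>N. G l (B g) = P (B g)" for g
      using G(2)[of "B g"] by (simp add: eventually_sequentially)
    have ex: "\<exists>N. \<not> (\<not> Q N g \<and> \<not> R N g)" for g
      using lim[of g] unfolding Q_def R_def by metis
    have PQ: "P (B g) = Q (LEAST N. \<not> (\<not> Q N g \<and> \<not> R N g)) g" for g
    proof -
      let ?N = "LEAST N. \<not> (\<not> Q N g \<and> \<not> R N g)"
      have "Q ?N g \<or> R ?N g" using LeastI_ex[OF ex[of g]] by blast
      moreover obtain M where "\<forall>l\<ge>M. G l (B g) = P (B g)" using lim by blast
      then have "G (max ?N M) (B g) = P (B g)" by simp
      ultimately show ?thesis unfolding Q_def R_def by (meson max.cobounded1)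
    qed
    have "baire (Suc r) (\<lambda>g. LEAST N. \<not> (\<not> Q N g \<and> \<not> R N g))"
      by (rule baire_Least[OF _ ex]) (intro baire_not baire_conj bQ bR)
    from baire_diag[of "Suc r" _ Q, OF this bQ] show ?thesis
      unfolding PQ .
  qed
  note main = this
  show ?case
  proof (intro exI[of _ "\<lambda>ys. G"] conjI allI impI)
    show "locally_const (G l)" for l by (rule G(1))
    fix r :: nat and B :: "(nat \<Rightarrow> nat) \<Rightarrow> nat \<Rightarrow> nat"
    assume W: "\<forall>(ys :: nat list) N v. baire (Suc r) (\<lambda>g. \<exists>l\<ge>N. G l (B g) \<noteq> v)"
    show "baire (Suc r + 0) (\<lambda>g. P (B g))"
      unfolding add_0_right by (rule main) (use W in blast)
  qed
next
  case (Suc m)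
  then obtain Q where Q: "\<And>i. baire (Suc m) (Q i)" "\<And>g. \<forall>\<^sub>F i in sequentially. Q i g = P g"
    unfolding baire.simps(2)[of "Suc m"] by blast
  have "\<forall>i. \<exists>F :: nat list \<Rightarrow> nat \<Rightarrow> (nat \<Rightarrow> nat) \<Rightarrow> bool. (\<forall>ys l. locally_const (F ys l)) \<and>
    (\<forall>r B. (\<forall>ys N v. baire (Suc r) (\<lambda>g. \<exists>l\<ge>N. F ys l (B g) \<noteq> v))
       \<longrightarrow> baire (Suc r + m) (\<lambda>g. Q i (B g)))"
    using Suc.IH Q(1) by blast
  from choice[OF this] obtain F :: "nat \<Rightarrow> nat list \<Rightarrow> nat \<Rightarrow> (nat \<Rightarrow> nat) \<Rightarrow> bool"
    where F0: "\<forall>i. (\<forall>ys l. locally_const (F i ys l)) \<and>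
    (\<forall>r B. (\<forall>ys N v. baire (Suc r) (\<lambda>g. \<exists>l\<ge>N. F i ys l (B g) \<noteq> v))
       \<longrightarrow> baire (Suc r + m) (\<lambda>g. Q i (B g)))"
    ..
  have F: "locally_const (F i ys l)"
    "(\<forall>(ys :: nat list) N v. baire (Suc r) (\<lambda>g. \<exists>l\<ge>N. F i ys l (B g) \<noteq> v))
       \<Longrightarrow> baire (Suc r + m) (\<lambda>g. Q i (B g))" for i ys l r B
    using F0[rule_format, of i] by blast+
  \<comment> \<open>The head of \<open>ys\<close> selects an approximation \<open>Q i\<close>, the
    tail a question about it; one family thus carries the questions of all limits. The empty list
    gets a constant as filler.\<close>
  define F' where "F' ys = (case ys of [] \<Rightarrow> (\<lambda>l b. True) | i # zs \<Rightarrow> F i zs)" for ys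
  have "baire (Suc r + Suc m) (\<lambda>g. P (B g))"
    if W: "\<forall>ys N v. baire (Suc r) (\<lambda>g. \<exists>l\<ge>N. F' ys l (B g) \<noteq> v)" for r B
  proof -
    have "baire (Suc r + m) (\<lambda>g. Q i (B g))" for i
    proof (rule F(2), intro allI)
      show "baire (Suc r) (\<lambda>g. \<exists>l\<ge>N. F i ys l (B g) \<noteq> v)" for ys N v
        using W[rule_format, of N "i # ys" v] by (simp add: F'_def)
    qed
    then have "baire (Suc (Suc r + m)) (\<lambda>g. P (B g))"
      by (rule baire_SucI[where G = "\<lambda>i g. Q i (B g)"]) (rule Q(2))
    then show ?thesis by (simp only: add_Suc_right)
  qed
  moreover have "locally_const (F' ys l)" for ys l
    by (cases ys) (auto simp: F'_def F(1) locally_const_const)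
  ultimately show ?case by blast
qed

section \<open>Use and determinism of oracle computations\<close>

lemma eval_deterministic:
  "eval A e xs y \<Longrightarrow> eval A e xs z \<Longrightarrow> y = z"
proof (induction arbitrary: z rule: eval.induct)
  case (eval_comp xs gs ys f y)
  from eval_comp.prems obtain zs where zs: "list_all2 (\<lambda>g y. eval A g xs y) gs zs" "eval A f zs z"
    by cases auto
  have "ys = zs"
    using eval_comp.IH(1) zs(1)
    by (intro nth_equalityI) (auto simp: list_all2_conv_all_nth)
  then show ?case using eval_comp.IH(2) zs(2) by blast
next
  case (eval_mn f y xs)
  from eval_mn.prems have z: "eval A f (z # xs) 0" "\<forall>u<z. \<exists>v. 0 < v \<and> eval A f (u # xs) v"
    by (cases, auto)+
  have "\<not> y < z" using z(2) eval_mn.IH by fastforce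
  moreover have "\<not> z < y" using z(1) eval_mn.IH by fastforce
  ultimately show ?case by simp
next
  case (eval_prim0 f xs y g)
  from eval_prim0.prems have "eval A f xs z" by cases auto
  then show ?case by (rule eval_prim0.IH)
next
  case (eval_primS f g n xs r y)
  from eval_primS.prems obtain q where "eval A (Prim f g) (n # xs) q" "eval A g (q # n # xs) z"
    by cases auto
  then show ?case using eval_primS.IH by blast
qed (erule eval.cases; simp)+

lemma uniform_bound:
  fixes Q :: "nat \<Rightarrow> nat \<Rightarrow> bool"
  assumes "\<And>i. i < N \<Longrightarrow> \<exists>m. Q i m" and "\<And>i m m'. Q i m \<Longrightarrow> m \<le> m' \<Longrightarrow> Q i m'"
  shows "\<exists>m. \<forall>i<N. Q i m"
  using assms(1)
proof (induction N)
  case (Suc N)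
  then obtain m1 m2 where "\<forall>i<N. Q i m1" "Q N m2" by (meson less_Suc_eq)
  then have "\<forall>i<Suc N. Q i (max m1 m2)"
    using assms(2) by (metis less_Suc_eq max.cobounded1 max.cobounded2)
  then show ?case ..
qed auto

text \<open>A derivation of \<open>eval\<close> is finite and queries the oracle at finitely many
  places. Together with determinism this makes Turing functionals continuous.\<close>

lemma eval_use:
  assumes "eval A e xs y"
  shows "\<exists>m. \<forall>A'. (\<forall>x<m. A' x = A x) \<longrightarrow> eval A' e xs y"
proof -
  define U where "U m e xs y \<longleftrightarrow> (\<forall>A'. (\<forall>x<m. A' x = A x) \<longrightarrow> eval A' e xs y)" for m e xs y
  have U_mono: "U m' e xs y" if "U m e xs y" "m \<le> m'" for m m' e xs y
    using that unfolding U_def by (meson order_less_le_trans)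
  have "\<exists>m. U m e xs y"
    using assms
  proof (induction rule: eval.induct)
    case (eval_orc x xs)
    have "eval A' Orc (x # xs) (A x)" if "\<forall>z<Suc x. A' z = A z" for A'
      using eval.eval_orc[of A' x xs] that by simp
    then show ?case unfolding U_def by blast
  next
    case (eval_comp xs gs ys f z)
    obtain m1 where m1: "U m1 f ys z" using eval_comp.IH by blast
    have "\<exists>m. \<forall>i<length gs. U m (gs ! i) xs (ys ! i)"
      by (rule uniform_bound)
        (use eval_comp.IH(1) U_mono in \<open>auto simp: list_all2_conv_all_nth\<close>)
    then obtain m2 where m2: "\<forall>i<length gs. U m2 (gs ! i) xs (ys ! i)" by blast
    have len: "length gs = length ys" using eval_comp.IH(1) list_all2_lengthD by blast
    have "U (max m1 m2) (Comp f gs) xs z"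
      unfolding U_def
    proof (intro allI impI)
      fix A' assume A': "\<forall>x<max m1 m2. A' x = A x"
      then have "eval A' f ys z" using m1 by (simp add: U_def)
      moreover have "list_all2 (\<lambda>g y. eval A' g xs y) gs ys"
        using A' m2 len by (simp add: list_all2_conv_all_nth U_def)
      ultimately show "eval A' (Comp f gs) xs z" by (rule eval.eval_comp[rotated])
    qed
    then show ?case ..
  next
    case (eval_primS f g n xs r z)
    then obtain m1 m2 where "U m1 (Prim f g) (n # xs) r" "U m2 g (r # n # xs) z" by blast
    then have "U (max m1 m2) (Prim f g) (n # xs) r" "U (max m1 m2) g (r # n # xs) z"
      using U_mono by (meson max.cobounded1 max.cobounded2)+
    then have "U (max m1 m2) (Prim f g) (Suc n # xs) z"
      unfolding U_def using eval.eval_primS by blast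
    then show ?case ..
  next
    case (eval_mn f y xs)
    obtain m1 where m1: "U m1 f (y # xs) 0" using eval_mn.IH by blast
    have "\<exists>m. \<forall>z<y. \<exists>v. 0 < v \<and> U m f (z # xs) v"
      by (rule uniform_bound) (use eval_mn.IH U_mono in blast)+
    then obtain m2 where m2: "\<forall>z<y. \<exists>v. 0 < v \<and> U m2 f (z # xs) v" by blast
    have "U (max m1 m2) (Mn f) xs y"
      unfolding U_def
    proof (intro allI impI)
      fix A' assume A': "\<forall>x<max m1 m2. A' x = A x"
      then have "eval A' f (y # xs) 0" using m1 by (simp add: U_def)
      moreover have "\<forall>z<y. \<exists>v. 0 < v \<and> eval A' f (z # xs) v"
      proof (intro allI impI)
        fix z assume "z < y"
        with m2 obtain v where "0 < v" "U m2 f (z # xs) v" by blast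
        then show "\<exists>v. 0 < v \<and> eval A' f (z # xs) v" using A' by (auto simp: U_def)
      qed
      ultimately show "eval A' (Mn f) xs y" by (rule eval.eval_mn)
    qed
    then show ?case ..
  qed (auto simp: U_def intro: eval.intros)
  then show ?thesis unfolding U_def .
qed

section \<open>Iterated limits\<close>

primrec iterated_lim :: "nat \<Rightarrow> (nat list \<Rightarrow> 'b) \<Rightarrow> 'b \<Rightarrow> bool" where
  "iterated_lim 0 X v \<longleftrightarrow> X [] = v"
| "iterated_lim (Suc m) X v \<longleftrightarrow> (\<forall>\<^sub>F i in sequentially. iterated_lim m (\<lambda>xs. X (i # xs)) v)"

text \<open>Unlike in \<open>locally_const\<close>, the modulus \<open>m\<close> is the same for all
  arguments; the recursion that defines the diagonal colouring relies on this.\<close>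

definition depends_below :: "nat \<Rightarrow> ((nat \<Rightarrow> nat) \<Rightarrow> 'b) \<Rightarrow> bool" where
  "depends_below m F \<longleftrightarrow> (\<forall>g g'. (\<forall>x<m. g' x = g x) \<longrightarrow> F g' = F g)"

text \<open>At stage \<open>m\<close>, \<open>X m\<close> uses the latest \<open>F i\<close> with
  \<open>i \<le> m\<close> whose value is already decided by the argument below \<open>m\<close>.
  Every \<open>F i\<close> is decided at some stage, so the index used eventually passes any point
  from which \<open>F i f = v\<close> holds.\<close>

lemma locally_const_unwind:
  assumes "\<And>i. locally_const (F i)"
  shows "\<exists>X. (\<forall>m. depends_below m (X m)) \<and>
    (\<forall>f v. (\<forall>\<^sub>F i in sequentially. F i f = v) \<longrightarrow> (\<forall>\<^sub>F m in sequentially. X m f = v))"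
proof -
  define D where "D m i f \<longleftrightarrow> (\<forall>f' f''. (\<forall>x<m. f' x = f x) \<longrightarrow> (\<forall>x<m. f'' x = f x) \<longrightarrow> F i f' = F i f'')" for m i f
  define I where "I m f = Max (insert 0 {i. i \<le> m \<and> D m i f})" for m f
  \<comment> \<open>The test is repeated because the inserted index \<open>0\<close>, which makes
    the maximum exist, may itself be undecided.\<close>
  define X where "X m f = (if D m (I m f) f then F (I m f) f else undefined)" for m f
  have D_cong: "D m i f' = D m i f" if "\<forall>x<m. f' x = f x" for m i f f'
    using that by (simp add: D_def)
  have "depends_below m (X m)" for m
    unfolding depends_below_def
  proof (intro allI impI)
    fix g g' :: "nat \<Rightarrow> nat"
    assume eq: "\<forall>x<m. g' x = g x"
    have "I m g' = I m g" by (simp add: I_def D_cong[OF eq])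
    moreover have "F (I m g) g' = F (I m g) g" if "D m (I m g) g"
      using that eq unfolding D_def by blast
    ultimately show "X m g' = X m g"
      using D_cong[OF eq, of "I m g"] unfolding X_def by simp
  qed
  moreover have "\<forall>\<^sub>F m in sequentially. X m f = v" if lim: "\<forall>\<^sub>F i in sequentially. F i f = v" for f v
  proof -
    obtain N where N: "\<And>i. i \<ge> N \<Longrightarrow> F i f = v" using lim by (auto simp: eventually_sequentially)
    obtain m0 where m0: "\<And>f'. (\<forall>x<m0. f' x = f x) \<Longrightarrow> F N f' = F N f"
      by (rule locally_constE[OF assms[of N], where g = f]) blast
    have "X m f = v" if m: "m \<ge> max N m0" for m
    proof -
      have "F N f' = F N f" if "\<forall>x<m. f' x = f x" for f'
        by (rule m0) (use that m in simp)
      then have "D m N f" unfolding D_def by metis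
      then have "N \<in> {i. i \<le> m \<and> D m i f}" using m by simp
      moreover have fin: "finite {i. i \<le> m \<and> D m i f}" by simp
      ultimately have ge: "I m f \<ge> N" unfolding I_def by (intro Max_ge) auto
      have "I m f \<in> insert 0 {i. i \<le> m \<and> D m i f}" unfolding I_def by (rule Max_in) auto
      then have "D m (I m f) f" using ge \<open>D m N f\<close> by auto
      then show ?thesis using N[OF ge] by (simp add: X_def)
    qed
    then show ?thesis unfolding eventually_sequentially by blast
  qed
  ultimately show ?thesis by blast
qed

text \<open>The limits behind each \<open>F i\<close> are unwound by induction, the innermost one by
  \<open>locally_const_unwind\<close>. Convergence is asked only at the given \<open>f\<close>,
  since a candidate set of the wrong colour may produce no limit.\<close>

lemma baire_unwind:
  assumes "\<And>i. baire m (F i)"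
  shows "\<exists>X. (\<forall>xs. length xs = Suc m \<longrightarrow> depends_below (last xs) (X xs)) \<and>
    (\<forall>f v. (\<forall>\<^sub>F i in sequentially. F i f = v) \<longrightarrow> iterated_lim (Suc m) (\<lambda>xs. X xs f) v)"
  using assms
proof (induction m arbitrary: F)
  case 0
  then obtain X where X: "\<And>m. depends_below m (X m)"
    "\<And>f v. (\<forall>\<^sub>F i in sequentially. F i f = v) \<Longrightarrow> (\<forall>\<^sub>F m in sequentially. X m f = v)"
    using locally_const_unwind[of F] by auto
  show ?case
    by (rule exI[of _ "\<lambda>xs. X (last xs)"]) (use X in auto)
next
  case (Suc m)
  have "\<exists>X. (\<forall>xs. length xs = Suc m \<longrightarrow> depends_below (last xs) (X xs)) \<and>
    (\<forall>f. iterated_lim (Suc m) (\<lambda>xs. X xs f) (F i f))" for i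
  proof -
    obtain G where G: "\<And>l. baire m (G l)" "\<And>f. \<forall>\<^sub>F l in sequentially. G l f = F i f"
      using Suc.prems[of i] by auto
    then show ?thesis using Suc.IH[of G] by blast
  qed
  then obtain X where X: "\<And>i xs. length xs = Suc m \<Longrightarrow> depends_below (last xs) (X i xs)"
    "\<And>i f. iterated_lim (Suc m) (\<lambda>xs. X i xs f) (F i f)"
    by metis
  define Y where "Y xs = X (hd xs) (tl xs)" for xs
  have "depends_below (last xs) (Y xs)" if "length xs = Suc (Suc m)" for xs
    using X(1)[of "tl xs" "hd xs"] that by (cases xs) (auto simp: Y_def)
  moreover have "iterated_lim (Suc (Suc m)) (\<lambda>xs. Y xs f) v"
    if "\<forall>\<^sub>F i in sequentially. F i f = v" for f v
    unfolding iterated_lim.simps(2)[of "Suc m"]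
    using that
  proof eventually_elim
    case (elim i)
    then show ?case using X(2)[of i f] by (simp only: Y_def list.sel)
  qed
  ultimately show ?case by blast
qed

text \<open>The entries are picked from \<open>H\<close> in turn, each beyond its predecessor and
  beyond the threshold of the current limit.\<close>

lemma iterated_lim_infinite_set:
  assumes "iterated_lim m X v" and "infinite H"
  shows "\<exists>xs. length xs = m \<and> sorted_wrt (<) xs \<and> set xs \<subseteq> H \<and> (\<forall>x\<in>set xs. b < x) \<and> X xs = v"
  using assms(1)
proof (induction m arbitrary: X b)
  case (Suc m)
  obtain N where N: "\<And>i. i \<ge> N \<Longrightarrow> iterated_lim m (\<lambda>xs. X (i # xs)) v"
    using Suc.prems by (auto simp: eventually_sequentially)
  obtain i where i: "i \<in> H" "i > max N b"
    using assms(2) by (metis infinite_nat_iff_unbounded)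
  obtain xs where "length xs = m" "sorted_wrt (<) xs" "set xs \<subseteq> H" "\<forall>x\<in>set xs. i < x" "X (i # xs) = v"
    using Suc.IH[OF N[of i], of i] i by auto
  then show ?case using i by (intro exI[of _ "i # xs"]) auto
qed auto

section \<open>A low basis theorem\<close>

text \<open>The path runs through nodes that have extensions of every length. Only children below
  \<open>j\<close> matter, so if all of them failed, a common failing length would exist.\<close>

lemma koenig:
  fixes T :: "nat list \<Rightarrow> bool"
  assumes closed: "\<And>xs ys. T (xs @ ys) \<Longrightarrow> T xs"
    and bounded: "\<And>xs. T xs \<Longrightarrow> set xs \<subseteq> {..<j}"
    and infinite: "\<And>l. \<exists>xs. length xs = l \<and> T xs"
  shows "\<exists>b. \<forall>l. T (map b [0..<l])"
proof -
  define ext where "ext xs \<longleftrightarrow> (\<forall>l. \<exists>ys. length ys = l \<and> T (xs @ ys))" for xs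
  have step: "\<exists>v. ext (xs @ [v])" if ext_xs: "ext xs" for xs
  proof (rule ccontr)
    assume "\<nexists>v. ext (xs @ [v])"
    then have "\<forall>v. \<exists>l. \<forall>ys. length ys = l \<longrightarrow> \<not> T ((xs @ [v]) @ ys)"
      unfolding ext_def by blast
    then obtain l where l: "\<And>v ys. length ys = l v \<Longrightarrow> \<not> T ((xs @ [v]) @ ys)" by metis
    define M where "M = Max (insert 0 (l ` {..<j}))"
    obtain zs where zs: "length zs = Suc M" "T (xs @ zs)"
      using ext_xs unfolding ext_def by blast
    then obtain v ys where vy: "zs = v # ys" by (cases zs) auto
    have "v < j" using bounded[OF zs(2)] vy by auto
    then have "l v \<le> M" unfolding M_def by (intro Max_ge) auto
    then have "length (take (l v) ys) = l v" using zs(1) vy by simp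
    moreover have "T (((xs @ [v]) @ take (l v) ys) @ drop (l v) ys)"
      using zs(2) vy by simp
    ultimately show False using l closed by blast
  qed
  define nxt where "nxt xs = (SOME v. ext (xs @ [v]))" for xs
  define p where "p = rec_nat [] (\<lambda>_ xs. xs @ [nxt xs])"
  have p_Suc: "p (Suc i) = p i @ [nxt (p i)]" for i by (simp add: p_def)
  have len: "length (p i) = i" for i by (induction i) (simp_all add: p_def)
  have ext_p: "ext (p i)" for i
  proof (induction i)
    case 0
    show ?case using infinite by (simp add: p_def ext_def)
  next
    case (Suc i)
    then show ?case using someI_ex[OF step] by (simp add: p_Suc nxt_def)
  qed
  have "map (\<lambda>i. nxt (p i)) [0..<i] = p i" for i
    by (induction i) (simp_all add: p_Suc, simp add: p_def)
  moreover have "T (p i)" for i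
    using ext_p[of i] unfolding ext_def by (metis append_Nil2 length_0_conv)
  ultimately show ?thesis by metis
qed

text \<open>The Jockusch--Soare forcing: the requirements \<open>W e\<close> are treated in turn, and \<open>W e\<close> is avoided
  whenever this leaves an infinite tree. Which requirements are avoided is decided one Baire class above
  the tree, and determines all truth values \<open>\<exists>l. W e (B g restricted to l)\<close>.\<close>

lemma low_basis:
  fixes T :: "(nat \<Rightarrow> nat) \<Rightarrow> nat list \<Rightarrow> bool" and W :: "nat \<Rightarrow> nat list \<Rightarrow> bool"
  assumes closed: "\<And>g xs ys. T g (xs @ ys) \<Longrightarrow> T g xs"
    and bounded: "\<And>g xs. T g xs \<Longrightarrow> set xs \<subseteq> {..<j}"
    and infinite: "\<And>g l. \<exists>xs. length xs = l \<and> T g xs"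
    and baire_T: "\<And>xs. baire m (\<lambda>g. T g xs)"
    and W_ext: "\<And>e xs ys. W e xs \<Longrightarrow> W e (xs @ ys)"
  shows "\<exists>B. (\<forall>g l. T g (map (B g) [0..<l])) \<and>
    (\<forall>e. baire (Suc m) (\<lambda>g. \<exists>l. W e (map (B g) [0..<l])))"
proof -
  \<comment> \<open>Labels are below \<open>j\<close>, so the existence of a node of length
    \<open>l\<close> is a finite disjunction. Hence \<open>inf K\<close> has a single unbounded
    quantifier, over \<open>l\<close>, and lies one class above the tree.\<close>
  define inf where "inf K g \<longleftrightarrow>
    (\<forall>l. \<exists>xs\<in>{xs. set xs \<subseteq> {..<j} \<and> length xs = l}. T g xs \<and> (\<forall>e\<in>set K. \<not> W e xs))" for K g
  define K where "K g = rec_nat [] (\<lambda>e K. if inf (e # K) g then e # K else K)" for g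
  have K_0: "K g 0 = []" for g by (simp add: K_def)
  have K_Suc: "K g (Suc e) = (if inf (e # K g e) g then e # K g e else K g e)" for g e
    by (simp add: K_def)
  have baire_inf: "baire (Suc m) (inf K)" for K
    unfolding inf_def
    by (intro baire_all baire_finite_Bex finite_lists_length_eq baire_conj baire_T baire_const) simp
  have baire_K: "baire (Suc m) (\<lambda>g. K g e)" for e
  proof (induction e)
    case 0
    show ?case unfolding K_0 by (rule baire_const)
  next
    case (Suc e)
    have "baire (Suc m) (\<lambda>g. if inf (e # L) g then e # L else L)" for L
      by (rule baire_comp[OF baire_inf])
    then show ?case unfolding K_Suc by (rule baire_diag[OF Suc])
  qed
  have inf_K: "inf (K g e) g" for g e
  proof (induction e)
    case 0
    have "\<exists>xs\<in>{xs. set xs \<subseteq> {..<j} \<and> length xs = l}. T g xs" for l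
      using infinite[of l g] bounded by blast
    then show ?case by (simp add: inf_def K_0)
  next
    case (Suc e)
    then show ?case by (simp add: K_Suc)
  qed
  have K_mono: "set (K g e) \<subseteq> set (K g e')" if "e \<le> e'" for g e e'
    using that by (induction e' rule: dec_induct) (auto simp: K_Suc)
  have "\<exists>b. \<forall>l. T g (map b [0..<l]) \<and> (\<forall>e. \<forall>i\<in>set (K g e). \<not> W i (map b [0..<l]))" for g
  proof (rule koenig[where j = j and T = "\<lambda>xs. T g xs \<and> (\<forall>e. \<forall>i\<in>set (K g e). \<not> W i xs)"])
    show "T g xs \<and> (\<forall>e. \<forall>i\<in>set (K g e). \<not> W i xs)"
      if "T g (xs @ ys) \<and> (\<forall>e. \<forall>i\<in>set (K g e). \<not> W i (xs @ ys))" for xs ys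
      using that closed W_ext by blast
    show "set xs \<subseteq> {..<j}" if "T g xs \<and> (\<forall>e. \<forall>i\<in>set (K g e). \<not> W i xs)" for xs
      using that bounded by blast
    show "\<exists>xs. length xs = l \<and> T g xs \<and> (\<forall>e. \<forall>i\<in>set (K g e). \<not> W i xs)" for l
    proof -
      let ?S = "{xs. set xs \<subseteq> {..<j} \<and> length xs = l}"
      have "\<forall>e. \<exists>xs. xs \<in> ?S \<and> T g xs \<and> (\<forall>i\<in>set (K g e). \<not> W i xs)"
        using inf_K unfolding inf_def by blast
      then obtain x where x: "\<And>e. x e \<in> ?S" "\<And>e. T g (x e)"
          "\<And>e i. i \<in> set (K g e) \<Longrightarrow> \<not> W i (x e)"
        by metis
      \<comment> \<open>Finitely many strings have length \<open>l\<close>, so one of them avoids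
        \<open>K g e\<close> for infinitely many \<open>e\<close>, and by monotonicity for all
        \<open>e\<close>.\<close>
      have "finite (range x)"
        by (rule finite_subset[OF _ finite_lists_length_eq[of "{..<j}" l]]) (use x(1) in auto)
      then obtain e0 where e0: "infinite {e. x e = x e0}"
        using pigeonhole_infinite[of UNIV x] by auto
      have "\<not> W i (x e0)" if "i \<in> set (K g e)" for e i
      proof -
        obtain e' where "e' \<ge> e" "x e' = x e0"
          using e0 unfolding infinite_nat_iff_unbounded_le by blast
        then show ?thesis using x(3)[of i e'] K_mono that by auto
      qed
      then show ?thesis using x(1,2)[of e0] by blast
    qed
  qed
  then obtain B where B: "\<And>g l. T g (map (B g) [0..<l])"
      "\<And>g l e i. i \<in> set (K g e) \<Longrightarrow> \<not> W i (map (B g) [0..<l])"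
    by metis
  \<comment> \<open>If \<open>e\<close> was refused, no node of some length avoids both
    \<open>W e\<close> and \<open>K g e\<close>. The path avoids \<open>K g e\<close>, so it must
    meet \<open>W e\<close>.\<close>
  have W_iff: "(\<exists>l. W e (map (B g) [0..<l])) \<longleftrightarrow> e \<notin> set (K g (Suc e))" for e g
  proof
    show "e \<notin> set (K g (Suc e))" if "\<exists>l. W e (map (B g) [0..<l])"
      using that B(2) by blast
    assume "e \<notin> set (K g (Suc e))"
    then have "\<not> inf (e # K g e) g" by (auto simp: K_Suc split: if_splits)
    then obtain l where l: "\<And>xs. set xs \<subseteq> {..<j} \<Longrightarrow> length xs = l \<Longrightarrow> T g xs \<Longrightarrow>
        \<exists>i\<in>set (e # K g e). W i xs"
      unfolding inf_def by blast
    have "\<exists>i\<in>set (e # K g e). W i (map (B g) [0..<l])"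
      by (rule l) (use B(1) bounded[OF B(1)] in auto)
    then show "\<exists>l. W e (map (B g) [0..<l])" using B(2) by auto
  qed
  have "baire (Suc m) (\<lambda>g. \<exists>l. W e (map (B g) [0..<l]))" for e
    unfolding W_iff by (rule baire_comp[OF baire_K])
  with B(1) show ?thesis by blast
qed

text \<open>\<open>UNIV\<close> is thinned out so that one \<open>h t\<close> after another becomes
  constant, and one element is taken from each stage. The set only witnesses that the Erdos-Rado
  tree is infinite, so its complexity does not enter.\<close>

lemma exists_cohesive:
  fixes h :: "nat \<Rightarrow> nat \<Rightarrow> nat"
  assumes "\<And>t y. h t y < j"
  shows "\<exists>C. infinite C \<and> (\<forall>t. \<exists>v. finite {y \<in> C. h t y \<noteq> v})"
proof -
  have "\<exists>v. infinite {y \<in> S. h t y = v}" if "infinite S" for S t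
  proof -
    have "finite (h t ` S)" by (rule finite_subset[of _ "{..<j}"]) (use assms in auto)
    then show ?thesis using pigeonhole_infinite[OF that] by auto
  qed
  then obtain v where v: "\<And>S t. infinite S \<Longrightarrow> infinite {y \<in> S. h t y = v S t}" by metis
  define S where "S = rec_nat UNIV (\<lambda>t S. {y \<in> S. h t y = v S t})"
  have S_Suc: "S (Suc t) = {y \<in> S t. h t y = v (S t) t}" for t by (simp add: S_def)
  have inf_S: "infinite (S t)" for t
    by (induction t) (simp add: S_def, simp add: S_Suc v)
  have S_anti: "S t' \<subseteq> S t" if "t \<le> t'" for t t'
    using that by (induction t' rule: dec_induct) (auto simp: S_Suc)
  have "\<exists>y\<in>S t. y > t" for t using inf_S[of t] infinite_nat_iff_unbounded by blast
  then obtain c where c: "\<And>t. c t \<in> S t" "\<And>t. c t > t" by metis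
  have "infinite (range c)"
    unfolding infinite_nat_iff_unbounded using c(2) by blast
  moreover have "finite {y \<in> range c. h t y \<noteq> v (S t) t}" for t
  proof (rule finite_subset)
    show "{y \<in> range c. h t y \<noteq> v (S t) t} \<subseteq> c ` {..t}"
    proof
      fix y assume "y \<in> {y \<in> range c. h t y \<noteq> v (S t) t}"
      then obtain u where u: "y = c u" "h t y \<noteq> v (S t) t" by blast
      then have "y \<notin> S (Suc t)" by (simp add: S_Suc)
      then have "\<not> Suc t \<le> u" using c(1)[of u] S_anti u(1) by blast
      then show "y \<in> c ` {..t}" using u(1) by simp
    qed
  qed simp
  ultimately show ?thesis by blast
qed

section \<open>The Erdos--Rado tree\<close>

lemma set_encode_less: "s \<subseteq> {..<N} \<Longrightarrow> set_encode s < 2 ^ N"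
proof -
  assume "s \<subseteq> {..<N}"
  then have "set_encode s \<le> sum ((^) 2) {..<N}"
    unfolding set_encode_def by (intro sum_mono2) auto
  also have "\<dots> < 2 ^ N"
    by (induction N) auto
  finally show ?thesis .
qed

text \<open>A sequence \<open>b\<close> codes a colouring of \<open>n\<close>-sets of indices. The list \<open>xs\<close> is \<open>greedy\<close> for \<open>b\<close> if each entry
  is the least one for which the colour under \<open>g mod j\<close> of an \<open>(n + 1)\<close>-set of entries with last index
  \<open>i\<close> is the value of \<open>b\<close> at its first \<open>n\<close> indices. Reducing modulo \<open>j\<close> makes every \<open>g\<close> a colouring.\<close>

definition fits :: "nat \<Rightarrow> nat \<Rightarrow> (nat \<Rightarrow> nat) \<Rightarrow> (nat \<Rightarrow> nat) \<Rightarrow> nat list \<Rightarrow> nat \<Rightarrow> bool" where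
  "fits n j g b xs y \<longleftrightarrow> (\<forall>x\<in>set xs. x < y) \<and>
    (\<forall>s\<in>{s. s \<subseteq> {..<length xs} \<and> card s = n}.
       g (set_encode (insert y ((!) xs ` s))) mod j = b (set_encode s))"

definition greedy :: "nat \<Rightarrow> nat \<Rightarrow> (nat \<Rightarrow> nat) \<Rightarrow> (nat \<Rightarrow> nat) \<Rightarrow> nat list \<Rightarrow> bool" where
  "greedy n j g b xs \<longleftrightarrow> (\<forall>i\<in>{..<length xs}. fits n j g b (take i xs) (xs ! i) \<and>
     (\<forall>y\<in>{..<xs ! i}. \<not> fits n j g b (take i xs) y))"

lemma fits_cong: "(\<And>x. x < 2 ^ length xs \<Longrightarrow> b x = b' x) \<Longrightarrow> fits n j g b xs y = fits n j g b' xs y"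
  unfolding fits_def using set_encode_less by auto

lemma greedy_cong:
  assumes "\<And>x. x < 2 ^ (length xs - 1) \<Longrightarrow> b x = b' x"
  shows "greedy n j g b xs = greedy n j g b' xs"
proof -
  have "fits n j g b (take i xs) y = fits n j g b' (take i xs) y" if "i < length xs" for i y
  proof (rule fits_cong)
    fix x :: nat
    assume "x < 2 ^ length (take i xs)"
    also have "\<dots> \<le> 2 ^ (length xs - 1)" using that by (intro power_increasing) auto
    finally show "b x = b' x" by (rule assms)
  qed
  then show ?thesis unfolding greedy_def by simp
qed

lemma baire_fits: "baire 0 (\<lambda>g. fits n j g b xs y)"
proof -
  have "baire 0 (\<lambda>g. g c mod j = v)" for c v
    unfolding baire.simps locally_const_def by (metis lessI)
  then show ?thesis
    unfolding fits_def by (intro baire_conj baire_const baire_finite_Ball) auto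
qed

lemma baire_greedy: "baire 0 (\<lambda>g. greedy n j g b xs)"
  unfolding greedy_def
  by (intro baire_finite_Ball baire_conj baire_not baire_fits finite_lessThan)

lemma greedy_take: "greedy n j g b xs \<Longrightarrow> greedy n j g b (take i xs)"
  unfolding greedy_def by (auto simp: min_def)

lemma greedy_unique:
  assumes "greedy n j g b xs" and "greedy n j g b ys" and "length xs = length ys"
  shows "xs = ys"
proof -
  have "i \<le> length xs \<Longrightarrow> take i xs = take i ys" for i
  proof (induction i)
    case (Suc i)
    then have eq: "take i xs = take i ys" and i: "i < length xs" "i < length ys"
      using assms(3) by auto
    have "\<not> xs ! i < ys ! i" "\<not> ys ! i < xs ! i"
      using assms(1,2) i eq unfolding greedy_def by (metis lessThan_iff)+
    then show ?case using eq i by (simp add: take_Suc_conv_app_nth)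
  qed simp
  from this[of "length xs"] show ?thesis using assms(3) by simp
qed

text \<open>Along a cohesive set \<open>C\<close> the colour of a fixed set extended by
  \<open>y\<close> has a limit \<open>v\<close>. If \<open>b\<close> prescribes these limits, almost
  every element of \<open>C\<close> fits as next entry, so the least choice never gets
  stuck.\<close>

lemma exists_greedy_path:
  assumes "j > 0"
  shows "\<exists>b. (\<forall>x. b x < j) \<and> (\<forall>i. \<exists>xs. length xs = i \<and> greedy n j g b xs)"
proof -
  define h where "h t y = g (set_encode (insert y (set_decode t))) mod j" for t y
  have h_less: "h t y < j" for t y using assms by (simp add: h_def)
  obtain C where C: "infinite C" "\<forall>t. \<exists>v. finite {y \<in> C. h t y \<noteq> v}"
    using exists_cohesive[of h j, OF h_less] by blast
  then obtain v where v: "\<And>t. finite {y \<in> C. h t y \<noteq> v t}" by metis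
  have v_less: "v t < j" for t
  proof (rule ccontr)
    assume "\<not> v t < j"
    then have "h t y \<noteq> v t" for y using h_less[of t y] by auto
    then have "{y \<in> C. h t y \<noteq> v t} = C" by simp
    then show False using v[of t] C(1) by simp
  qed
  define ok where "ok xs y \<longleftrightarrow> (\<forall>x\<in>set xs. x < y) \<and>
    (\<forall>s\<in>{s. s \<subseteq> {..<length xs} \<and> card s = n}.
       h (set_encode ((!) xs ` s)) y = v (set_encode ((!) xs ` s)))" for xs y
  have ex_ok: "\<exists>y. ok xs y" for xs
  proof -
    define Bad where "Bad s = {y \<in> C. h (set_encode ((!) xs ` s)) y \<noteq> v (set_encode ((!) xs ` s))}" for s
    let ?U = "(\<Union>x\<in>set xs. {..x}) \<union> (\<Union>s\<in>{s. s \<subseteq> {..<length xs} \<and> card s = n}. Bad s)"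
    have "finite (Bad s)" for s unfolding Bad_def by (rule v)
    then have "finite ?U" by simp
    then have "infinite (C - ?U)" using C(1) by (rule Diff_infinite_finite)
    then have "C - ?U \<noteq> {}" by (rule infinite_imp_nonempty)
    then obtain y where y: "y \<in> C" "y \<notin> ?U" by blast
    have "x < y" if "x \<in> set xs" for x
      using y(2) that by (meson UN_I UnI1 atMost_iff not_le)
    moreover have "y \<notin> Bad s" if "s \<subseteq> {..<length xs}" "card s = n" for s
      using y(2) that by blast
    ultimately have "ok xs y" using y(1) unfolding ok_def Bad_def by simp
    then show ?thesis ..
  qed
  define L where "L = rec_nat [] (\<lambda>_ xs. xs @ [LEAST y. ok xs y])"
  define a where "a i = (LEAST y. ok (L i) y)" for i
  have L_map: "L i = map a [0..<i]" for i
    by (induction i) (simp_all add: L_def a_def)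
  \<comment> \<open>\<open>v\<close> takes codes of sets of entries, \<open>b\<close> codes of sets
    of indices; \<open>a\<close> translates.\<close>
  define b where "b x = v (set_encode (a ` set_decode x))" for x
  have fits_ok: "fits n j g b (L i) y = ok (L i) y" for i y
  proof -
    have "(g (set_encode (insert y ((!) (L i) ` s))) mod j = b (set_encode s)) =
       (h (set_encode ((!) (L i) ` s)) y = v (set_encode ((!) (L i) ` s)))"
      if s: "s \<subseteq> {..<i}" for s
    proof -
      have fin: "finite s" using s finite_subset by blast
      have "(!) (L i) ` s = a ` s" using s by (intro image_cong) (auto simp: L_map)
      then show ?thesis using fin by (simp add: h_def b_def)
    qed
    then show ?thesis unfolding fits_def ok_def by (auto simp: L_map)
  qed
  have "greedy n j g b (L i)" for i
    unfolding greedy_def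
  proof (intro ballI conjI)
    fix l assume "l \<in> {..<length (L i)}"
    then have l: "take l (L i) = L l" "L i ! l = a l" by (auto simp: L_map take_map)
    show "fits n j g b (take l (L i)) (L i ! l)"
      unfolding l fits_ok a_def by (rule LeastI_ex) (rule ex_ok)
    show "\<not> fits n j g b (take l (L i)) y" if "y \<in> {..<L i ! l}" for y
      using that not_less_Least unfolding l fits_ok a_def by auto
  qed
  moreover have "length (L i) = i" for i by (simp add: L_map)
  moreover have "b x < j" for x by (simp add: b_def v_less)
  ultimately show ?thesis by blast
qed

section \<open>The tree of codes of greedy sequences and its paths\<close>

definition prolong :: "nat list \<Rightarrow> nat \<Rightarrow> nat" where
  "prolong xs x = (if x < length xs then xs ! x else 0)"

text \<open>A list of length \<open>Suc i\<close> is tested against \<open>b\<close> only below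
  \<open>2 ^ i\<close>, so \<open>2 ^ i \<le> length t\<close> keeps \<open>greedy\<close> away from
  the default of \<open>prolong\<close>. The unbounded search for \<open>xs\<close> puts the tree in
  class 1.\<close>

definition erdos_rado :: "nat \<Rightarrow> nat \<Rightarrow> (nat \<Rightarrow> nat) \<Rightarrow> nat list \<Rightarrow> bool" where
  "erdos_rado n j g t \<longleftrightarrow> set t \<subseteq> {..<j} \<and>
    (\<forall>i\<in>{i. i \<le> length t \<and> 2 ^ i \<le> length t}.
       \<exists>xs. length xs = Suc i \<and> greedy n j g (prolong t) xs)"

lemma baire_erdos_rado: "baire 1 (\<lambda>g. erdos_rado n j g t)"
  unfolding erdos_rado_def One_nat_def
  by (intro baire_conj baire_const baire_finite_Ball baire_ex baire_greedy) simp

lemma erdos_rado_closed: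
  assumes "erdos_rado n j g (xs @ ys)"
  shows "erdos_rado n j g xs"
  unfolding erdos_rado_def
proof (intro conjI ballI)
  show "set xs \<subseteq> {..<j}" using assms by (simp add: erdos_rado_def)
  fix i assume i: "i \<in> {i. i \<le> length xs \<and> 2 ^ i \<le> length xs}"
  then obtain zs where zs: "length zs = Suc i" "greedy n j g (prolong (xs @ ys)) zs"
    using assms unfolding erdos_rado_def by (fastforce dest: bspec[of _ _ i])
  have "greedy n j g (prolong (xs @ ys)) zs = greedy n j g (prolong xs) zs"
    by (rule greedy_cong) (use i zs(1) in \<open>auto simp: prolong_def nth_append\<close>)
  then show "\<exists>zs. length zs = Suc i \<and> greedy n j g (prolong xs) zs" using zs by blast
qed

lemma erdos_rado_prefix_iff:
  "(\<forall>l. erdos_rado n j g (map b [0..<l])) \<longleftrightarrow>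
    (\<forall>x. b x < j) \<and> (\<forall>i. \<exists>xs. length xs = Suc i \<and> greedy n j g b xs)"
proof -
  have cong: "greedy n j g (prolong (map b [0..<l])) xs = greedy n j g b xs"
    if "length xs = Suc i" "2 ^ i \<le> l" for xs i l
    by (rule greedy_cong) (use that in \<open>auto simp: prolong_def\<close>)
  show ?thesis
  proof (intro iffI conjI allI)
    assume T: "\<forall>l. erdos_rado n j g (map b [0..<l])"
    show "b x < j" for x
      using T[rule_format, of "Suc x"] by (auto simp: erdos_rado_def)
    show "\<exists>xs. length xs = Suc i \<and> greedy n j g b xs" for i
    proof -
      have "i \<le> 2 ^ i" by (simp add: less_imp_le)
      then have "\<exists>xs. length xs = Suc i \<and> greedy n j g (prolong (map b [0..<2 ^ i])) xs"
        using T[rule_format, of "2 ^ i"] by (simp add: erdos_rado_def)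
      then show ?thesis using cong[of _ i "2 ^ i"] by auto
    qed
  next
    fix l
    assume "(\<forall>x. b x < j) \<and> (\<forall>i. \<exists>xs. length xs = Suc i \<and> greedy n j g b xs)"
    then show "erdos_rado n j g (map b [0..<l])"
      unfolding erdos_rado_def using cong by fastforce
  qed
qed

text \<open>Greedy lists of a given length are unique, so those of all lengths are initial segments
  of one sequence.\<close>

lemma greedy_pathE:
  assumes "\<And>i. \<exists>xs. length xs = Suc i \<and> greedy n j g b xs"
  obtains a :: "nat \<Rightarrow> nat"
  where "strict_mono a"
    and "\<And>s i. s \<subseteq> {..<i} \<Longrightarrow> card s = n \<Longrightarrow>
      g (set_encode (insert (a i) (a ` s))) mod j = b (set_encode s)"
    and "\<And>i. greedy n j g b (map a [0..<i])"
proof -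
  obtain L where len: "\<And>i. length (L i) = Suc i" and gr: "\<And>i. greedy n j g b (L i)"
    using assms by metis
  define a where "a i = last (L i)" for i
  have L: "L i = map a [0..<Suc i]" for i
  proof (rule nth_equalityI)
    show "length (L i) = length (map a [0..<Suc i])" using len by simp
    fix l assume "l < length (L i)"
    then have l: "l \<le> i" by (simp add: len)
    have "take (Suc l) (L i) = L l"
      by (rule greedy_unique[OF greedy_take[OF gr] gr]) (use l in \<open>simp add: len\<close>)
    then have "L l ! l = L i ! l" using l by (metis lessI nth_take)
    moreover have "last (L l) = L l ! l"
      using len[of l] by (subst last_conv_nth) auto
    ultimately show "L i ! l = map a [0..<Suc i] ! l"
      using l by (simp add: a_def del: upt_Suc)
  qed
  have fits: "fits n j g b (map a [0..<i]) (a i)" for i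
  proof -
    have "i \<in> {..<length (L i)}" by (simp add: len)
    then have "fits n j g b (take i (L i)) (L i ! i)" using gr[of i] unfolding greedy_def by blast
    then show ?thesis by (simp add: L take_map nth_append)
  qed
  show ?thesis
  proof
    show "strict_mono a"
      unfolding strict_mono_Suc_iff using fits by (auto simp: fits_def)
    show "g (set_encode (insert (a i) (a ` s))) mod j = b (set_encode s)"
      if s: "s \<subseteq> {..<i}" "card s = n" for s i
    proof -
      have "(!) (map a [0..<i]) ` s = a ` s" using s by (intro image_cong) auto
      then show ?thesis using fits[of i] s by (auto simp: fits_def)
    qed
    show "greedy n j g b (map a [0..<i])" for i
      using greedy_take[OF gr[of i], of i] by (simp add: L take_map del: upt_Suc)
  qed
qed

text \<open>A path \<open>B g\<close> of the tree colours \<open>Suc m\<close>-sets of indices by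
  the colour under \<open>g\<close> after adding any later entry, so the sequence \<open>a g\<close>
  carries homogeneous sets for \<open>B g\<close> to homogeneous sets for \<open>g\<close>.
  \<open>B\<close> is of class 2; its controlled jump keeps \<open>H c (B g)\<close> in class
  \<open>Suc (Suc m)\<close> instead of one higher.\<close>

lemma baire_homogeneous_step:
  fixes H :: "nat \<Rightarrow> (nat \<Rightarrow> nat) \<Rightarrow> nat \<Rightarrow> bool"
  assumes "j > 0"
    and baire_H: "\<And>c z. baire (Suc m) (\<lambda>g. H c g z)"
    and hom_H: "\<And>g. \<exists>c<j. infinite {z. H c g z} \<and>
      (\<forall>s. s \<subseteq> {z. H c g z} \<and> finite s \<and> card s = Suc m \<longrightarrow> g (set_encode s) mod j = c)"
  shows "\<exists>H' :: nat \<Rightarrow> (nat \<Rightarrow> nat) \<Rightarrow> nat \<Rightarrow> bool.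
    (\<forall>c z. baire (Suc (Suc m)) (\<lambda>g. H' c g z)) \<and>
    (\<forall>g. \<exists>c<j. infinite {z. H' c g z} \<and>
      (\<forall>s. s \<subseteq> {z. H' c g z} \<and> finite s \<and> card s = Suc (Suc m) \<longrightarrow> g (set_encode s) mod j = c))"
proof -
  define S where "S c z F \<longleftrightarrow> (\<forall>ys l. locally_const (F ys l)) \<and>
    (\<forall>r B. (\<forall>ys N v. baire (Suc r) (\<lambda>g. \<exists>l\<ge>N. F ys l (B g) \<noteq> v))
       \<longrightarrow> baire (Suc r + m) (\<lambda>g. H c (B g) z))"
    for c z and F :: "nat list \<Rightarrow> nat \<Rightarrow> (nat \<Rightarrow> nat) \<Rightarrow> bool"
  have "\<exists>F. S c z F" for c z
    unfolding S_def by (rule baire_jump_comp) (rule baire_H)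
  then obtain F where "\<And>c z. S c z (F c z)" by metis
  then have F_lc: "locally_const (F c z ys l)"
    and F_comp: "(\<And>ys N v. baire (Suc r) (\<lambda>g. \<exists>l\<ge>N. F c z ys l (B g) \<noteq> v))
       \<Longrightarrow> baire (Suc r + m) (\<lambda>g. H c (B g) z)" for c z ys l r B
    unfolding S_def by blast+
  \<comment> \<open>Requirements for \<open>low_basis\<close>: \<open>Inl\<close> is met once a
    finite part of the path forces a positive answer to a question from
    \<open>baire_jump_comp\<close>, and \<open>Inr\<close> reads off a value of the path.\<close>
  define V :: "(nat \<times> nat \<times> nat list \<times> nat \<times> bool) + (nat \<times> nat) \<Rightarrow> nat list \<Rightarrow> bool"
    where "V e t = (case e of
       Inl (c, z, ys, N, v) \<Rightarrow> \<exists>l\<ge>N. \<forall>b. (\<forall>x<length t. b x = t ! x) \<longrightarrow> F c z ys l b \<noteq> v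
     | Inr (x, v) \<Rightarrow> x < length t \<and> t ! x = v)" for e t
  have V_ext: "V e (xs @ ys)" if V: "V e xs" for e xs ys
  proof (cases e)
    case (Inl p)
    obtain c z us N v where p: "p = (c, z, us, N, v)" by (cases p) auto
    obtain l where l: "l \<ge> N" "\<And>b. (\<forall>x<length xs. b x = xs ! x) \<Longrightarrow> F c z us l b \<noteq> v"
      using V unfolding V_def Inl p by auto
    have "F c z us l b \<noteq> v" if "\<forall>x<length (xs @ ys). b x = (xs @ ys) ! x" for b
      by (rule l(2)) (use that in \<open>auto simp: nth_append\<close>)
    then show ?thesis unfolding V_def Inl p using l(1) by auto
  qed (use V in \<open>auto simp: V_def nth_append\<close>)
  have inf_ER: "\<exists>xs. length xs = l \<and> erdos_rado (Suc m) j g xs" for g l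
  proof -
    obtain b where "\<forall>l. erdos_rado (Suc m) j g (map b [0..<l])"
      using exists_greedy_path[OF \<open>j > 0\<close>, of "Suc m" g] unfolding erdos_rado_prefix_iff by blast
    then show ?thesis by (intro exI[of _ "map b [0..<l]"]) simp
  qed
  have ER_bounded: "set xs \<subseteq> {..<j}" if "erdos_rado (Suc m) j g xs" for g xs
    using that by (simp add: erdos_rado_def)
  have "\<exists>B. (\<forall>g l. erdos_rado (Suc m) j g (map (B g) [0..<l])) \<and>
      (\<forall>e. baire (Suc 1) (\<lambda>g. \<exists>l. V (from_nat e) (map (B g) [0..<l])))"
    by (rule low_basis[where T = "erdos_rado (Suc m) j" and W = "\<lambda>e. V (from_nat e)" and m = 1,
          OF erdos_rado_closed ER_bounded inf_ER baire_erdos_rado V_ext])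
  then obtain B where BB: "(\<forall>g l. erdos_rado (Suc m) j g (map (B g) [0..<l])) \<and>
      (\<forall>e. baire (Suc 1) (\<lambda>g. \<exists>l. V (from_nat e) (map (B g) [0..<l])))" ..
  have B: "\<forall>l. erdos_rado (Suc m) j g (map (B g) [0..<l])" for g
    using conjunct1[OF BB] by (rule spec)
  have baire_V': "baire (Suc 1) (\<lambda>g. \<exists>l. V (from_nat e) (map (B g) [0..<l]))" for e
    using conjunct2[OF BB] by (rule spec)
  have baire_V: "baire (Suc 1) (\<lambda>g. \<exists>l. V e (map (B g) [0..<l]))" for e
    using baire_V'[of "to_nat e"] by (simp only: from_nat_to_nat)
  have B_less: "B g x < j" and B_greedy: "\<exists>xs. length xs = Suc i \<and> greedy (Suc m) j g (B g) xs" for g x i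
    using B[of g] unfolding erdos_rado_prefix_iff by auto
  have baire_B: "baire (Suc 1) (\<lambda>g. B g x)" for x
  proof -
    have iff: "(\<exists>l. V (Inr (x, v)) (map (B g) [0..<l])) \<longleftrightarrow> B g x = v" for g v
      by (auto simp: V_def intro!: exI[of _ "Suc x"] simp del: upt_Suc)
    have "baire (Suc 1) (\<lambda>g. LEAST v. B g x = v)"
      by (rule baire_Least) (use baire_V[of "Inr (x, _)"] in \<open>simp_all only: iff, blast\<close>)
    moreover have "(LEAST v. B g x = v) = B g x" for g by (rule Least_equality) auto
    ultimately show ?thesis by simp
  qed
  have baire_HB: "baire (Suc (Suc m)) (\<lambda>g. H c (B g) z)" for c z
  proof -
    have "baire (Suc 1 + m) (\<lambda>g. H c (B g) z)"
    proof (rule F_comp)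
      fix ys N v
      have "(\<exists>l. V (Inl (c, z, ys, N, v)) (map b [0..<l])) \<longleftrightarrow> (\<exists>l\<ge>N. F c z ys l b \<noteq> v)" for b
      proof
        show "\<exists>l\<ge>N. F c z ys l b \<noteq> v" if "\<exists>l. V (Inl (c, z, ys, N, v)) (map b [0..<l])"
          using that by (auto simp: V_def)
        assume "\<exists>l\<ge>N. F c z ys l b \<noteq> v"
        then obtain l where l: "l \<ge> N" "F c z ys l b \<noteq> v" by blast
        obtain k where k: "\<And>b'. (\<forall>x<k. b' x = b x) \<Longrightarrow> F c z ys l b' = F c z ys l b"
          by (rule locally_constE[OF F_lc, where g = b]) blast
        have "F c z ys l b' \<noteq> v" if "\<forall>x<length (map b [0..<k]). b' x = map b [0..<k] ! x" for b'
          using k[of b'] that l(2) by simp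
        then have "V (Inl (c, z, ys, N, v)) (map b [0..<k])"
          unfolding V_def using l(1) by auto
        then show "\<exists>l. V (Inl (c, z, ys, N, v)) (map b [0..<l])" ..
      qed
      then show "baire (Suc 1) (\<lambda>g. \<exists>l\<ge>N. F c z ys l (B g) \<noteq> v)"
        using baire_V[of "Inl (c, z, ys, N, v)"] by (simp only:)
    qed
    then show ?thesis by (simp only: One_nat_def add_Suc add_0_left)
  qed
  have baire_greedy_B: "baire (Suc (Suc m)) (\<lambda>g. greedy (Suc m) j g (B g) xs)" for xs
  proof -
    let ?N = "2 ^ (length xs - 1) :: nat"
    have eq: "greedy (Suc m) j g (B g) xs =
        greedy (Suc m) j g (prolong (map (B g) [0..<?N])) xs" for g
      by (rule greedy_cong) (simp add: prolong_def)
    have "baire (Suc 1) (\<lambda>g. greedy (Suc m) j g (prolong (map (\<lambda>x. B g x) [0..<?N])) xs)"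
      by (rule baire_diag[where R = "\<lambda>t g. greedy (Suc m) j g (prolong t) xs"])
        (rule baire_map[OF baire_B], rule baire_mono[OF _ baire_greedy], simp)
    then show ?thesis
      unfolding eq by (rule baire_mono[rotated]) simp
  qed
  have "\<exists>a. strict_mono a \<and> (\<forall>s i. s \<subseteq> {..<i} \<longrightarrow> card s = Suc m \<longrightarrow>
        g (set_encode (insert (a i) (a ` s))) mod j = B g (set_encode s)) \<and>
      (\<forall>i. greedy (Suc m) j g (B g) (map a [0..<i]))" for g
    using greedy_pathE[OF B_greedy, of g thesis for thesis] by metis
  then obtain a where a_mono: "\<And>g. strict_mono (a g)"
    and a_col: "\<And>g s i. s \<subseteq> {..<i} \<Longrightarrow> card s = Suc m \<Longrightarrow>
        g (set_encode (insert (a g i) (a g ` s))) mod j = B g (set_encode s)"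
    and a_greedy: "\<And>g i. greedy (Suc m) j g (B g) (map (a g) [0..<i])"
    by metis
  define H' where "H' c g z \<longleftrightarrow> (\<exists>i. H c (B g) i \<and> a g i = z)" for c g z
  have a_ge: "i \<le> a g i" for g i by (rule strict_mono_imp_increasing[OF a_mono])
  have "baire (Suc (Suc m)) (\<lambda>g. H' c g z)" for c z
  proof -
    \<comment> \<open>Since \<open>a g\<close> increases, the initial segment ending in
      \<open>z\<close> lies in \<open>{..z}\<close>; with \<open>i \<le> a g i\<close> all
      quantifiers in \<open>H'\<close> become finite and cost no limit.\<close>
    have "a g i = z \<longleftrightarrow> (\<exists>xs\<in>{xs. set xs \<subseteq> {..z} \<and> length xs = Suc i}.
        greedy (Suc m) j g (B g) xs \<and> last xs = z)" for g i
    proof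
      assume z: "a g i = z"
      have "set (map (a g) [0..<Suc i]) \<subseteq> {..z}"
        using z strict_mono_mono[OF a_mono[of g]] by (auto simp: mono_def less_Suc_eq_le simp del: upt_Suc)
      then show "\<exists>xs\<in>{xs. set xs \<subseteq> {..z} \<and> length xs = Suc i}.
          greedy (Suc m) j g (B g) xs \<and> last xs = z"
        using z a_greedy[of g "Suc i"] by (intro bexI[of _ "map (a g) [0..<Suc i]"]) auto
    next
      assume "\<exists>xs\<in>{xs. set xs \<subseteq> {..z} \<and> length xs = Suc i}.
          greedy (Suc m) j g (B g) xs \<and> last xs = z"
      then obtain xs where xs: "length xs = Suc i" "greedy (Suc m) j g (B g) xs" "last xs = z"
        by blast
      have "xs = map (a g) [0..<Suc i]"
        by (rule greedy_unique[OF xs(2) a_greedy]) (simp add: xs(1))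
      then show "a g i = z" using xs(3) by simp
    qed
    then have "H' c g z \<longleftrightarrow> (\<exists>i\<in>{..z}. H c (B g) i \<and>
        (\<exists>xs\<in>{xs. set xs \<subseteq> {..z} \<and> length xs = Suc i}.
          greedy (Suc m) j g (B g) xs \<and> last xs = z))" for g
      unfolding H'_def using a_ge by fastforce
    then show ?thesis
      by (simp only:) (intro baire_finite_Bex baire_conj baire_HB baire_greedy_B baire_const
          finite_atMost finite_lists_length_eq)
  qed
  moreover have "\<exists>c<j. infinite {z. H' c g z} \<and>
      (\<forall>s. s \<subseteq> {z. H' c g z} \<and> finite s \<and> card s = Suc (Suc m) \<longrightarrow> g (set_encode s) mod j = c)" for g
  proof -
    obtain c where c: "c < j" "infinite {z. H c (B g) z}"
      "\<And>s. s \<subseteq> {z. H c (B g) z} \<Longrightarrow> finite s \<Longrightarrow> card s = Suc m \<Longrightarrow> B g (set_encode s) mod j = c"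
      using hom_H[of "B g"] by blast
    have inj: "inj (a g)" using a_mono strict_mono_imp_inj_on by blast
    have H'_image: "{z. H' c g z} = a g ` {i. H c (B g) i}" by (auto simp: H'_def)
    then have "infinite {z. H' c g z}"
      using c(2) inj finite_imageD subset_UNIV inj_on_subset by metis
    moreover have "g (set_encode s) mod j = c"
      if s: "s \<subseteq> {z. H' c g z}" "finite s" "card s = Suc (Suc m)" for s
    proof -
      obtain w where w: "w \<subseteq> {i. H c (B g) i}" "s = a g ` w"
        using s(1) unfolding H'_image by (meson subset_image_iff)
      have card_w: "card w = Suc (Suc m)" "finite w"
        using s w(2) inj by (metis card_image inj_on_subset subset_UNIV, metis finite_image_iff inj_on_subset subset_UNIV)
      define i where "i = Max w"
      have i: "i \<in> w" unfolding i_def by (rule Max_in) (use card_w in auto)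
      have sub: "w - {i} \<subseteq> {..<i}"
        using Max_ge[OF card_w(2)] unfolding i_def by (auto simp: less_le)
      have card: "card (w - {i}) = Suc m" using card_w i by simp
      have "insert (a g i) (a g ` (w - {i})) = s" using i w(2) by blast
      then have "g (set_encode s) mod j = B g (set_encode (w - {i}))"
        using a_col[OF sub card, of g] by (simp only:)
      also have "\<dots> = B g (set_encode (w - {i})) mod j" using B_less by simp
      also have "\<dots> = c" by (rule c(3)) (use w(1) card_w(2) card in auto)
      finally show ?thesis .
    qed
    ultimately show ?thesis using c(1) by blast
  qed
  ultimately show ?thesis by blast
qed

text \<open>For singletons the colour classes serve as candidates, one of them being infinite by the
  pigeonhole principle; each further exponent costs one class.\<close>

theorem baire_homogeneous:
  assumes "j > 0"
  shows "\<exists>H :: nat \<Rightarrow> (nat \<Rightarrow> nat) \<Rightarrow> nat \<Rightarrow> bool.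
    (\<forall>c z. baire (Suc m) (\<lambda>g. H c g z)) \<and>
    (\<forall>g. \<exists>c<j. infinite {z. H c g z} \<and>
      (\<forall>s. s \<subseteq> {z. H c g z} \<and> finite s \<and> card s = Suc m \<longrightarrow> g (set_encode s) mod j = c))"
proof (induction m)
  case 0
  define H where "H c g z \<longleftrightarrow> g (set_encode {z}) mod j = c" for c z and g :: "nat \<Rightarrow> nat"
  have "baire (Suc 0) (\<lambda>g. H c g z)" for c z
  proof (rule baire_Suc)
    show "baire 0 (\<lambda>g. H c g z)"
      unfolding baire.simps locally_const_def H_def by (metis lessI)
  qed
  moreover have "\<exists>c<j. infinite {z. H c g z} \<and>
      (\<forall>s. s \<subseteq> {z. H c g z} \<and> finite s \<and> card s = Suc 0 \<longrightarrow> g (set_encode s) mod j = c)" for g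
  proof -
    have "finite ((\<lambda>z. g (set_encode {z}) mod j) ` UNIV)"
      by (rule finite_subset[of _ "{..<j}"]) (use assms in auto)
    then obtain z0 where "infinite {z. g (set_encode {z}) mod j = g (set_encode {z0}) mod j}"
      using pigeonhole_infinite[of UNIV "\<lambda>z. g (set_encode {z}) mod j"] by auto
    then show ?thesis
      using assms by (intro exI[of _ "g (set_encode {z0}) mod j"]) (auto simp: H_def card_1_singleton_iff)
  qed
  ultimately show ?case by blast
next
  case (Suc m)
  then obtain H :: "nat \<Rightarrow> (nat \<Rightarrow> nat) \<Rightarrow> nat \<Rightarrow> bool" where
    "\<And>c z. baire (Suc m) (\<lambda>g. H c g z)"
    "\<And>g. \<exists>c<j. infinite {z. H c g z} \<and>
      (\<forall>s. s \<subseteq> {z. H c g z} \<and> finite s \<and> card s = Suc m \<longrightarrow> g (set_encode s) mod j = c)"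
    by blast
  then show ?case by (rule baire_homogeneous_step[OF assms])
qed

section \<open>The diagonal colouring\<close>

text \<open>Lowering the minimum lowers the code, which allows the diagonal colouring to be defined
  by recursion on codes.\<close>

lemma set_encode_replace_Min_less:
  assumes "finite s" "s \<noteq> {}" "x < Min s"
  shows "set_encode (insert x (s - {Min s})) < set_encode s"
proof -
  have "x \<notin> s" using assms Min_le by fastforce
  then have "set_encode (insert x (s - {Min s})) = 2 ^ x + set_encode (s - {Min s})"
    using assms(1) by simp
  also have "\<dots> < 2 ^ Min s + set_encode (s - {Min s})" using assms(3) by simp
  also have "\<dots> = set_encode (insert (Min s) (s - {Min s}))"
    using assms(1) by (subst set_encode_insert) auto
  also have "insert (Min s) (s - {Min s}) = s" using Min_in[OF assms(1,2)] by blast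
  finally show ?thesis .
qed

lemma in_set_less_set_encode: "finite s \<Longrightarrow> x \<in> s \<Longrightarrow> x < set_encode s"
proof -
  assume "finite s" "x \<in> s"
  have "x < 2 ^ x" by simp
  also have "2 ^ x \<le> set_encode s"
    unfolding set_encode_def using \<open>finite s\<close> \<open>x \<in> s\<close> by (intro member_le_sum) auto
  finally show ?thesis .
qed

lemma exists_recursive_function:
  fixes F :: "nat \<Rightarrow> (nat \<Rightarrow> 'a) \<Rightarrow> 'a"
  assumes "\<And>y f f'. (\<And>x. x < y \<Longrightarrow> f x = f' x) \<Longrightarrow> F y f = F y f'"
  shows "\<exists>f. \<forall>y. f y = F y f"
proof -
  define f where "f = wfrec less_than (\<lambda>f y. F y f)"
  have "f y = F y f" for y
  proof -
    have "f y = F y (cut f less_than y)" unfolding f_def by (rule wfrec) simp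
    also have "\<dots> = F y f" by (rule assms) (simp add: cut_def)
    finally show ?thesis .
  qed
  then show ?thesis by blast
qed

text \<open>At most \<open>j\<close> values are forbidden, so one of the \<open>j + 1\<close> values
  up to \<open>j\<close> is free.\<close>

lemma Least_notin_image:
  fixes h :: "'c \<Rightarrow> nat"
  assumes "finite C" "card C \<le> j" "j < k"
  shows "(LEAST v. v \<notin> h ` C) < k" and "(LEAST v. v \<notin> h ` C) \<notin> h ` C"
proof -
  have "card (h ` C) \<le> j" using card_image_le[OF assms(1), of h] assms(2) by simp
  then have "\<not> {..j} \<subseteq> h ` C" using card_mono[of "h ` C" "{..j}"] assms(1) by auto
  then obtain v where v: "v \<le> j" "v \<notin> h ` C" by auto
  show "(LEAST v. v \<notin> h ` C) \<notin> h ` C" by (rule LeastI[of _ v]) (rule v(2))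
  have "(LEAST v. v \<notin> h ` C) \<le> v" by (rule Least_le) (rule v(2))
  then show "(LEAST v. v \<notin> h ` C) < k" using v(1) assms(3) by simp
qed

text \<open>If \<open>X c\<close> approximates, in the sense of iterated limits, the least element of an infinite set
  homogeneous for the colouring \<open>f\<close> below, then along that set the colour of \<open>{x1, x2, \<dots>, xn}\<close>
  differs from that of \<open>{X c, x2, \<dots>, xn}\<close>. As only \<open>j\<close> colours are forbidden, \<open>k > j\<close> suffice.\<close>

lemma exists_diagonal_coloring:
  fixes X :: "nat \<Rightarrow> nat list \<Rightarrow> (nat \<Rightarrow> nat) \<Rightarrow> nat"
  assumes "n > 0" "j < k"
    and dep: "\<And>c xs. length xs = n \<Longrightarrow> depends_below (last xs) (X c xs)"
  shows "\<exists>f. (\<forall>y. f y < k) \<and> (\<forall>y. card (set_decode y) \<noteq> n \<longrightarrow> f y = 0) \<and>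
    (\<forall>s c. finite s \<longrightarrow> card s = n \<longrightarrow> c < j \<longrightarrow> X c (sorted_list_of_set s) f < Min s \<longrightarrow>
       f (set_encode (insert (X c (sorted_list_of_set s) f) (s - {Min s}))) \<noteq> f (set_encode s))"
proof -
  \<comment> \<open>Only those \<open>c\<close> are kept for which exchanging the minimum gives a
    smaller code, so that the forbidden colour is already known.\<close>
  define D where "D s f = {c. c < j \<and> X c (sorted_list_of_set s) f < Min s}" for s f
  define h where "h s f c = f (set_encode (insert (X c (sorted_list_of_set s) f) (s - {Min s})))"
    for s and f :: "nat \<Rightarrow> nat" and c
  define F where "F y f = (if card (set_decode y) = n
      then LEAST v. v \<notin> h (set_decode y) f ` D (set_decode y) f else 0)" for y f
  \<comment> \<open>The recursion is well-founded: \<open>X c\<close> reads \<open>f\<close> below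
    the last element of the set, which is less than its code \<open>y\<close>, and the exchanged
    sets have codes below \<open>y\<close>.\<close>
  have "F y f = F y f'" if eq: "\<And>x. x < y \<Longrightarrow> f x = f' x" for y f f'
  proof (cases "card (set_decode y) = n")
    case True
    let ?s = "set_decode y"
    let ?xs = "sorted_list_of_set ?s"
    have s: "finite ?s" "?s \<noteq> {}" using True \<open>n > 0\<close> by auto
    have len: "length ?xs = n" using True by simp
    then have "last ?xs \<in> ?s" using \<open>n > 0\<close> s(1) by (metis last_in_set length_0_conv less_irrefl set_sorted_list_of_set)
    then have "last ?xs < y" using in_set_less_set_encode[OF s(1)] by simp
    then have X_eq: "X c ?xs f = X c ?xs f'" for c
      using dep[OF len, of c] eq unfolding depends_below_def by (meson order_less_trans)
    have D_eq: "D ?s f = D ?s f'" by (simp add: D_def X_eq)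
    have "h ?s f c = h ?s f' c" if "c \<in> D ?s f" for c
    proof -
      have "X c ?xs f < Min ?s" using that by (simp add: D_def)
      then have "set_encode (insert (X c ?xs f) (?s - {Min ?s})) < y"
        using set_encode_replace_Min_less[OF s] by simp
      then show ?thesis using eq by (simp add: h_def X_eq)
    qed
    then have "h ?s f ` D ?s f = h ?s f' ` D ?s f'" unfolding D_eq by (intro image_cong) auto
    then show ?thesis by (simp add: F_def)
  qed (simp add: F_def)
  then obtain f where f: "\<And>y. f y = F y f" using exists_recursive_function[of F] by blast
  have D: "finite (D s f)" "card (D s f) \<le> j" for s
  proof -
    have "D s f \<subseteq> {..<j}" by (auto simp: D_def)
    then show "finite (D s f)" "card (D s f) \<le> j"
      using finite_subset card_mono[of "{..<j}" "D s f"] by auto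
  qed
  have "f y < k" for y
    using Least_notin_image(1)[OF D \<open>j < k\<close>] \<open>j < k\<close> by (subst f) (auto simp: F_def)
  moreover have "f y = 0" if "card (set_decode y) \<noteq> n" for y
    by (subst f) (simp add: F_def that)
  moreover have "f (set_encode (insert (X c (sorted_list_of_set s) f) (s - {Min s}))) \<noteq> f (set_encode s)"
    if s: "finite s" "card s = n" and c: "c < j" "X c (sorted_list_of_set s) f < Min s" for s c
  proof -
    have "f (set_encode s) = (LEAST v. v \<notin> h s f ` D s f)"
      by (subst f) (simp add: F_def s)
    then have "f (set_encode s) \<notin> h s f ` D s f"
      using Least_notin_image(2)[OF D \<open>j < k\<close>] by simp
    moreover have "h s f c \<in> h s f ` D s f" by (rule imageI) (simp add: D_def c)
    ultimately have "h s f c \<noteq> f (set_encode s)" by auto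
    then show ?thesis by (simp add: h_def)
  qed
  ultimately show ?thesis by blast
qed

text \<open>By the use principle finitely many bits of \<open>H\<close> decide whether
  \<open>x \<in> Y\<close>, and these are eventually right. Quantifying over all \<open>b\<close>
  with the given first \<open>i\<close> bits makes the test depend on \<open>Q i z\<close> for
  \<open>z < i\<close> only.\<close>

lemma eventually_Least_output:
  assumes S: "computes e (chr H) (chr Y)" and "Y \<noteq> {}"
    and lim: "\<And>z. \<forall>\<^sub>F i in sequentially. Q i z = (z \<in> H)"
  shows "\<forall>\<^sub>F i in sequentially.
    (LEAST x. x = i \<or> (\<forall>b. (\<forall>z<i. b z = of_bool (Q i z)) \<longrightarrow> eval b e [x] 1)) = (LEAST x. x \<in> Y)"
proof (rule eventually_bounded_Least)
  show "\<exists>x. x \<in> Y" using \<open>Y \<noteq> {}\<close> by blast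
  fix x
  have "eval (chr H) e [x] (chr Y x)" using S by (simp add: computes_def)
  from eval_use[OF this] obtain m where
    m: "\<forall>b. (\<forall>z<m. b z = chr H z) \<longrightarrow> eval b e [x] (chr Y x)" ..
  have "\<forall>\<^sub>F i in sequentially. \<forall>z<m. Q i z = (z \<in> H)"
    by (rule eventually_ball_less) (rule lim)
  then show "\<forall>\<^sub>F i in sequentially.
      (\<forall>b. (\<forall>z<i. b z = of_bool (Q i z)) \<longrightarrow> eval b e [x] 1) = (x \<in> Y)"
    using eventually_ge_at_top[of m]
  proof eventually_elim
    case (elim i)
    have ev: "eval b e [x] (chr Y x)" if "\<forall>z<i. b z = of_bool (Q i z)" for b
      by (rule m[THEN spec, THEN mp]) (use that elim in \<open>auto simp: chr_def\<close>)
    show ?case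
    proof
      assume "\<forall>b. (\<forall>z<i. b z = of_bool (Q i z)) \<longrightarrow> eval b e [x] 1"
      then have "eval (\<lambda>z. of_bool (Q i z)) e [x] 1"
        by (elim allE[of _ "\<lambda>z. of_bool (Q i z)"] impE) simp_all
      moreover have "eval (\<lambda>z. of_bool (Q i z)) e [x] (chr Y x)" by (rule ev) simp
      ultimately have "1 = chr Y x" by (rule eval_deterministic)
      then show "x \<in> Y" by (auto simp: chr_def split: if_splits)
    next
      assume "x \<in> Y"
      then show "\<forall>b. (\<forall>z<i. b z = of_bool (Q i z)) \<longrightarrow> eval b e [x] 1"
        using ev by (simp add: chr_def)
    qed
  qed
qed

theorem theorem3p1:
  fixes n j k :: nat
  assumes "n \<ge> 1" and "j \<ge> 2" and "k \<ge> 2" and "j < k"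
  shows "\<not> sW_le (RT n k) (RT n j)"
proof
  assume "sW_le (RT n k) (RT n j)"
  then obtain Phi Psi where red: "\<And>A. A \<in> inst (RT n k) \<Longrightarrow> \<exists>B. computes Phi A B \<and> B \<in> inst (RT n j) \<and>
       (\<forall>T \<in> sols (RT n j) B. \<exists>S. computes Psi T S \<and> S \<in> sols (RT n k) A)"
    unfolding sW_le_def by blast
  obtain m where n: "n = Suc m" using \<open>n \<ge> 1\<close> by (cases n) auto
  have "j > 0" "k > 0" using assms by auto
  \<comment> \<open>\<open>N\<close> turns every \<open>f\<close> into the name of an instance, so
    that \<open>G\<close> is total on Baire space.\<close>
  define N where "N f = col_name n (\<lambda>s. f (set_encode s) mod k)" for f
  have N_inst: "N f \<in> inst (RT n k)" for f
    using \<open>k > 0\<close> by (auto simp: RT_def N_def coloring_def)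
  obtain G where G_comp: "\<And>f. computes Phi (N f) (G f)" and G_inst: "\<And>f. G f \<in> inst (RT n j)"
    and G_sols: "\<And>f T. T \<in> sols (RT n j) (G f) \<Longrightarrow> \<exists>S. computes Psi T S \<and> S \<in> sols (RT n k) (N f)"
    using red[OF N_inst] by metis
  have G_lc: "locally_const (\<lambda>f. G f x)" for x
    unfolding locally_const_def
  proof
    fix f
    have "eval (N f) Phi [x] (G f x)" using G_comp by (simp add: computes_def)
    from eval_use[OF this] obtain M where
      M: "\<forall>A'. (\<forall>y<M. A' y = N f y) \<longrightarrow> eval A' Phi [x] (G f x)" ..
    have "G f' x = G f x" if "\<forall>y<M. f' y = f y" for f'
    proof -
      have "eval (N f') Phi [x] (G f x)"
        by (rule M[THEN spec, THEN mp]) (use that in \<open>simp add: N_def col_name_def\<close>)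
      moreover have "eval (N f') Phi [x] (G f' x)" using G_comp by (simp add: computes_def)
      ultimately show ?thesis using eval_deterministic by blast
    qed
    then show "\<exists>M. \<forall>f'. (\<forall>y<M. f' y = f y) \<longrightarrow> G f' x = G f x" by blast
  qed
  obtain H :: "nat \<Rightarrow> (nat \<Rightarrow> nat) \<Rightarrow> nat \<Rightarrow> bool" where
    baire_H: "\<And>c z. baire (Suc m) (\<lambda>g. H c g z)" and
    hom_H: "\<And>g. \<exists>c<j. infinite {z. H c g z} \<and>
      (\<forall>s. s \<subseteq> {z. H c g z} \<and> finite s \<and> card s = Suc m \<longrightarrow> g (set_encode s) mod j = c)"
    using baire_homogeneous[OF \<open>j > 0\<close>, of m] by blast
  \<comment> \<open>The outermost of the \<open>Suc m\<close> limits is split off: it becomes the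
    stage at which the output of \<open>Psi\<close> is approximated. The other \<open>m\<close> are
    left to \<open>baire_unwind\<close>.\<close>
  have "\<exists>Q. (\<forall>i. baire m (Q i)) \<and> (\<forall>f. \<forall>\<^sub>F i in sequentially. Q i f = H c (G f) z)" for c z
    using baire_precomp[OF baire_H G_lc] unfolding baire.simps .
  then obtain Q where Q: "\<And>c z i. baire m (Q c z i)"
    "\<And>c z f. \<forall>\<^sub>F i in sequentially. Q c z i f = H c (G f) z"
    by metis
  define P where "P c i x f \<longleftrightarrow> (\<forall>b. (\<forall>z<i. b z = of_bool (Q c z i f)) \<longrightarrow> eval b Psi [x] 1)"
    for c i x f
  have baire_P: "baire m (P c i x)" for c i x
  proof -
    define R where "R l \<longleftrightarrow> (\<forall>b. (\<forall>z<i. b z = of_bool (l ! z)) \<longrightarrow> eval b Psi [x] 1)" for l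
    have "P c i x = (\<lambda>f. R (map (\<lambda>z. Q c z i f) [0..<i]))"
      by (auto simp: P_def R_def fun_eq_iff)
    moreover have "baire m (\<lambda>f. R (map (\<lambda>z. Q c z i f) [0..<i]))"
      by (rule baire_comp) (rule baire_map, rule Q(1))
    ultimately show ?thesis by simp
  qed
  define A where "A c X \<longleftrightarrow> (\<forall>xs. length xs = Suc m \<longrightarrow> depends_below (last xs) (X xs)) \<and>
    (\<forall>f v. (\<forall>\<^sub>F i in sequentially. (LEAST x. x = i \<or> P c i x f) = v) \<longrightarrow>
       iterated_lim (Suc m) (\<lambda>xs. X xs f) v)" for c X
  have "\<exists>X. A c X" for c
    unfolding A_def by (rule baire_unwind) (rule baire_bounded_Least, rule baire_P)
  then obtain X where "\<And>c. A c (X c)" by metis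
  then have X_dep: "length xs = n \<Longrightarrow> depends_below (last xs) (X c xs)"
    and X_lim: "(\<forall>\<^sub>F i in sequentially. (LEAST x. x = i \<or> P c i x f) = v) \<Longrightarrow>
       iterated_lim n (\<lambda>xs. X c xs f) v" for c xs f v
    unfolding A_def n by blast+
  have "n > 0" using \<open>n \<ge> 1\<close> by simp
  from exists_diagonal_coloring[OF this \<open>j < k\<close> X_dep] obtain f where
    f: "(\<forall>y. f y < k) \<and> (\<forall>y. card (set_decode y) \<noteq> n \<longrightarrow> f y = 0) \<and>
    (\<forall>s c. finite s \<longrightarrow> card s = n \<longrightarrow> c < j \<longrightarrow> X c (sorted_list_of_set s) f < Min s \<longrightarrow>
       f (set_encode (insert (X c (sorted_list_of_set s) f) (s - {Min s}))) \<noteq> f (set_encode s))" ..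
  note f_less = f[THEN conjunct1, rule_format]
  note f_0 = f[THEN conjunct2, THEN conjunct1, rule_format]
  note f_diag = f[THEN conjunct2, THEN conjunct2, rule_format]
  have N_f: "N f = f"
  proof
    show "N f y = f y" for y
      using f_less[of y] f_0[of y] by (simp add: N_def col_name_def)
  qed
  have G_less: "G f y < j" for y
  proof -
    obtain h where h: "G f = col_name n h" "coloring n j h"
      using G_inst[of f] by (auto simp: RT_def)
    have "h (set_decode y) < j" if "card (set_decode y) = n"
      using h(2) that by (simp add: coloring_def)
    then show ?thesis unfolding h(1) col_name_def using \<open>j > 0\<close> by simp
  qed
  obtain c where c: "c < j" "infinite {z. H c (G f) z}"
    "\<And>s. s \<subseteq> {z. H c (G f) z} \<Longrightarrow> finite s \<Longrightarrow> card s = n \<Longrightarrow> G f (set_encode s) = c"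
    using hom_H[of "G f"] unfolding n mod_less[OF G_less] by blast
  have "chr {z. H c (G f) z} \<in> sols (RT n j) (G f)"
    using c by (auto simp: RT_def homogeneous_name_def)
  then obtain Y where Y: "computes Psi (chr {z. H c (G f) z}) (chr Y)" "homogeneous_name n f Y"
    using G_sols[of _ f] unfolding N_f by (auto simp: RT_def)
  then have Y_inf: "infinite Y" by (simp add: homogeneous_name_def)
  let ?x = "LEAST x. x \<in> Y"
  have Y_ne: "Y \<noteq> {}" using Y_inf by (rule infinite_imp_nonempty)
  then have x_Y: "?x \<in> Y" unfolding ex_in_conv[symmetric] by (rule LeastI_ex)
  have "iterated_lim n (\<lambda>xs. X c xs f) ?x"
  proof (rule X_lim)
    show "\<forall>\<^sub>F i in sequentially. (LEAST x. x = i \<or> P c i x f) = ?x"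
      unfolding P_def
      by (rule eventually_Least_output[OF Y(1)]) (simp_all add: Y_ne Q(2))
  qed
  \<comment> \<open>With \<open>xs\<close> chosen in \<open>Y\<close> above \<open>?x\<close>, the
    value \<open>X c xs f = ?x\<close> lies below the minimum. Exchanging the minimum for
    \<open>?x\<close> thus gives a second \<open>n\<close>-subset of \<open>Y\<close>, of a
    different colour.\<close>
  from iterated_lim_infinite_set[OF this Y_inf, of ?x]
  obtain xs where xs: "length xs = n" "sorted_wrt (<) xs" "set xs \<subseteq> Y"
      "\<forall>x\<in>set xs. ?x < x" "X c xs f = ?x"
    by (elim exE conjE) (rule that)
  let ?s = "set xs"
  have sl: "sorted_list_of_set ?s = xs"
    using xs(2) by (simp add: sorted_list_of_set.idem_if_sorted_distinct strict_sorted_iff)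
  have card_s: "card ?s = n" using xs(1,2) by (metis distinct_card strict_sorted_iff)
  have "?s \<noteq> {}" using card_s \<open>n \<ge> 1\<close> by auto
  then have Min_s: "Min ?s \<in> ?s" by simp
  let ?t = "insert ?x (?s - {Min ?s})"
  have "f (set_encode ?t) \<noteq> f (set_encode ?s)"
    using f_diag[of ?s c] c(1) card_s xs(4) Min_s unfolding sl xs(5) by simp
  moreover have "card ?t = n"
    using card_s Min_s xs(4) \<open>n \<ge> 1\<close> by (subst card_insert_disjoint) auto
  moreover have "?t \<subseteq> Y" using x_Y xs(3) by blast
  moreover obtain e where e: "\<forall>s. s \<subseteq> Y \<and> finite s \<and> card s = n \<longrightarrow> f (set_encode s) = e"
    using Y(2) unfolding homogeneous_name_def by (elim conjE exE) (rule that)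
  ultimately show False
    using e[THEN spec[of _ ?s]] e[THEN spec[of _ ?t]] xs(3) card_s by simp
qed

end
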